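(* Let $X$ be a compact metric space with metric $\rho$ and $T\colon X\to X$ a homeomorphism. Suppose that $(x_m)_{m=1}^\infty\subseteq X$ and for each $m\ge1$ the point $x_m$ is generic for a mixing (ergodic) $T$-invariant Borel probability measure $\mu_m$ on $X$. If $x\in X$ is such that $\lim_{m\to\infty}D_B(x,x_m)=0$, then $x$ is a generic point for a mixing $T$-invariant Borel probability measure $\mu$ on $X$.
   Context: A point $x\in X$ is generic for a $T$-invariant Borel probability measure $\mu$ if $\frac1n\sum_{j=0}^{n-1}f(T^j(x))\to\int f\,d\mu$ for every continuous $f\colon X\to\mathbb{C}$. $D_B(x,x')=\limsup_{N\to\infty}\frac1N\sum_{n=0}^{N-1}\rho(T^n(x),T^n(x'))$ is the Besicovitch pseudometric. Mixing means strong mixing: $\mu(A\cap T^{-n}B)\to\mu(A)\mu(B)$ as $n\to\infty$ for all Borel sets $A,B\subseteq X$. *)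

theory Defs
  imports "HOL-Probability.Probability"
begin

text \<open>The compact metric space \<open>X\<close> is the universe of a type of class \<^class>\<open>metric_space\<close>,
  with \<open>\<rho> = dist\<close>.\<close>

definition invariant_prob :: "('a::metric_space \<Rightarrow> 'a) \<Rightarrow> 'a measure \<Rightarrow> bool" where
  "invariant_prob T \<mu> \<longleftrightarrow>
     prob_space \<mu> \<and> sets \<mu> = sets borel \<and>
     (\<forall>A \<in> sets borel. measure \<mu> (T -` A) = measure \<mu> A)"

definition generic_point :: "('a::metric_space \<Rightarrow> 'a) \<Rightarrow> 'a measure \<Rightarrow> 'a \<Rightarrow> bool" where
  "generic_point T \<mu> x \<longleftrightarrow>
     (\<forall>f :: 'a \<Rightarrow> complex. continuous_on UNIV f \<longrightarrow>
        (\<lambda>n. (\<Sum>j<n. f ((T ^^ j) x)) / of_nat n) \<longlonglongrightarrow> integral\<^sup>L \<mu> f)"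

text \<open>The upper limit is taken in the extended reals, where it always exists.\<close>

definition besicovitch :: "('a::metric_space \<Rightarrow> 'a) \<Rightarrow> 'a \<Rightarrow> 'a \<Rightarrow> ereal" where
  "besicovitch T x y =
     limsup (\<lambda>N. ereal ((\<Sum>n<N. dist ((T ^^ n) x) ((T ^^ n) y)) / real N))"

text \<open>\<open>T\<close>-invariance of \<open>\<mu>\<close> is not part of the next two predicates; it is always
  required separately.\<close>

definition mixing :: "('a::metric_space \<Rightarrow> 'a) \<Rightarrow> 'a measure \<Rightarrow> bool" where
  "mixing T \<mu> \<longleftrightarrow>
     (\<forall>A \<in> sets borel. \<forall>B \<in> sets borel.
        (\<lambda>n. measure \<mu> (A \<inter> (T ^^ n) -` B)) \<longlonglongrightarrow> measure \<mu> A * measure \<mu> B)"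

definition ergodic :: "('a::metric_space \<Rightarrow> 'a) \<Rightarrow> 'a measure \<Rightarrow> bool" where
  "ergodic T \<mu> \<longleftrightarrow>
     (\<forall>A \<in> sets borel. T -` A = A \<longrightarrow> measure \<mu> A = 0 \<or> measure \<mu> A = 1)"

end

theory Submission
  imports Defs
begin

text \<open>
  The averages of a continuous function \<open>f\<close> along the orbit of \<open>x\<close> are eventually as close as desired to
  those along the orbit of some \<open>x\<^sub>m\<close>, by uniform continuity of \<open>f\<close>
  (\<open>besicovitch_imp_orbits_close\<close>). The latter converge, so the former are Cauchy. Their limits form
  a positive normalised functional on the continuous functions, and the Riesz theorem
  (\<open>riesz_representation\<close>) turns it into an invariant measure \<open>\<nu>\<close> for which \<open>x\<close> is generic
  (\<open>exists_generic_measure\<close>).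

  It remains to see that \<open>\<nu>\<close> inherits mixing and ergodicity. Both properties say that the
  correlations \<open>\<integral> u \<cdot> (v \<circ> T^n) - \<integral> u \<cdot> \<integral> v\<close> of indicators of Borel sets tend to \<open>0\<close>: mixing in
  the usual sense (\<open>mixing_iff_means_vanish\<close>), ergodicity in the sense of Cesaro
  (\<open>ergodic_iff_means_vanish\<close>). The second equivalence needs the pointwise ergodic theorem for
  ergodic measures (\<open>ergodic_birkhoff\<close>), which follows from the maximal inequality. In both cases
  indicators may be replaced by continuous functions, by approximation in \<open>L1\<close>
  (\<open>decorrelation_continuous_iff_sets\<close>).

  For continuous \<open>f\<close> and \<open>g\<close> the correlation at time \<open>n\<close> is determined by averages along a generic
  orbit. Passing from the orbit of \<open>x\<close> to that of \<open>x\<^sub>m\<close> therefore changes it by an amount that is small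
  uniformly in \<open>n\<close> when \<open>m\<close> is large (\<open>generic_corr_diff_le\<close>): shifting two orbits by \<open>n\<close> steps
  does not change their mean distance in the limit. A uniform limit of sequences whose means vanish
  again has vanishing means, so the decay of correlations passes from the \<open>\<mu>\<^sub>m\<close> to \<open>\<nu>\<close>.
\<close>

section \<open>The Riesz representation of a normalised positive functional\<close>

text \<open>The case \<open>U = UNIV\<close> is separate because the distance to the empty set is \<open>0\<close> by
  convention, which would make the function vanish identically.\<close>

definition bump :: "'a::metric_space set \<Rightarrow> nat \<Rightarrow> 'a \<Rightarrow> real" where
  "bump U n y = (if U = UNIV then 1 else min 1 (real n * infdist y (- U)))"

lemma continuous_bump: "continuous_on UNIV (bump U n)"
  unfolding bump_def by (cases "U = UNIV") (auto intro!: continuous_intros)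

lemma bump_bounds: "0 \<le> bump U n y" "bump U n y \<le> 1"
  by (auto simp: bump_def infdist_nonneg)

lemma bump_outside: "y \<notin> U \<Longrightarrow> bump U n y = 0"
  by (auto simp: bump_def)

lemma bump_mono:
  assumes "m \<le> n"
  shows "bump U m y \<le> bump U n y"
proof -
  have "real m * infdist y (- U) \<le> real n * infdist y (- U)"
    using assms by (intro mult_right_mono) (auto simp: infdist_nonneg)
  then show ?thesis unfolding bump_def by (simp del: infdist_nonneg) linarith
qed

lemma eventually_bump_eq_1:
  assumes "open U" "y \<in> U"
  shows "eventually (\<lambda>n. bump U n y = 1) sequentially"
proof (cases "U = UNIV")
  case False
  then have "infdist y (- U) > 0"
    using assms in_closed_iff_infdist_zero[of "- U" y] infdist_nonneg[of y "- U"]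
    by (metis Compl_empty_eq ComplD closed_Compl double_complement less_eq_real_def)
  then obtain N where N: "1 < real N * infdist y (- U)"
    using reals_Archimedean3 by blast
  then show ?thesis
    using bump_mono[of N _ U y] bump_bounds[of U _ y] False
    by (intro eventually_sequentiallyI[of N])
       (metis bump_def less_imp_le min.absorb1 order_antisym)
qed (simp add: bump_def)

lemma bump_tendsto_indicator:
  assumes "open U"
  shows "(\<lambda>n. bump U n y) \<longlonglongrightarrow> indicator U y"
proof (cases "y \<in> U")
  case True
  then show ?thesis
    using eventually_bump_eq_1[OF assms] by (auto intro!: tendsto_eventually)
next
  case False
  then show ?thesis by (simp add: bump_outside)
qed

text \<open>The test functions of the Riesz construction. They are only asked to vanish off \<open>U\<close>, not to
  have support inside \<open>U\<close>; on a compact space the truncation \<open>max 0 (f - e)\<close> passes from the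
  first class to the second at the cost of a uniform error \<open>e\<close>.\<close>

definition subordinate :: "'a::metric_space set \<Rightarrow> ('a \<Rightarrow> real) set" where
  "subordinate U = {f. continuous_on UNIV f \<and> (\<forall>y. 0 \<le> f y \<and> f y \<le> 1) \<and> (\<forall>y. y \<notin> U \<longrightarrow> f y = 0)}"

lemma bump_subordinate: "bump U n \<in> subordinate U"
  by (simp add: subordinate_def continuous_bump bump_bounds bump_outside)

text \<open>Limits of averages along an orbit, when they exist for every continuous function, form such a
  functional; the locale is used for that one.\<close>

locale mean_functional =
  fixes L :: "('a::metric_space \<Rightarrow> real) \<Rightarrow> real"
  assumes compact_UNIV: "compact (UNIV :: 'a set)"
    and L_add: "continuous_on UNIV f \<Longrightarrow> continuous_on UNIV g \<Longrightarrow> L (\<lambda>y. f y + g y) = L f + L g"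
    and L_scale: "continuous_on UNIV f \<Longrightarrow> L (\<lambda>y. c * f y) = c * L f"
    and L_mono: "continuous_on UNIV f \<Longrightarrow> continuous_on UNIV g \<Longrightarrow> (\<And>y. f y \<le> g y) \<Longrightarrow> L f \<le> L g"
    and L_one: "L (\<lambda>_. 1) = 1"
begin

lemma L_const: "L (\<lambda>_. c) = c"
  using L_scale[of "\<lambda>_. 1" c] by (simp add: L_one)

lemma L_nonneg: "continuous_on UNIV f \<Longrightarrow> (\<And>y. 0 \<le> f y) \<Longrightarrow> 0 \<le> L f"
  using L_mono[of "\<lambda>_. 0" f] by (simp add: L_const)

lemma L_sum:
  assumes "finite I" "\<And>i. i \<in> I \<Longrightarrow> continuous_on UNIV (f i)"
  shows "L (\<lambda>y. \<Sum>i\<in>I. f i y) = (\<Sum>i\<in>I. L (f i))"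
  using assms
proof (induction I rule: finite_induct)
  case (insert i I)
  then show ?case
    using L_add[of "f i" "\<lambda>y. \<Sum>i\<in>I. f i y"] by (simp add: continuous_on_sum)
qed (simp add: L_const)

definition open_mass :: "'a set \<Rightarrow> ennreal" where
  "open_mass U = (SUP f\<in>subordinate U. ennreal (L f))"

definition outer :: "'a set \<Rightarrow> ennreal" where
  "outer A = (INF U\<in>{U. open U \<and> A \<subseteq> U}. open_mass U)"

lemma L_le_open_mass: "f \<in> subordinate U \<Longrightarrow> ennreal (L f) \<le> open_mass U"
  unfolding open_mass_def by (rule SUP_upper)

lemma open_mass_mono: "U \<subseteq> V \<Longrightarrow> open_mass U \<le> open_mass V"
  unfolding open_mass_def by (rule SUP_subset_mono) (auto simp: subordinate_def)

lemma open_mass_le_1: "open_mass U \<le> 1"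
  unfolding open_mass_def
proof (rule SUP_least)
  fix f :: "'a \<Rightarrow> real" assume "f \<in> subordinate U"
  then have "L f \<le> 1"
    using L_mono[of f "\<lambda>_. 1"] by (simp add: subordinate_def L_one)
  then show "ennreal (L f) \<le> 1" by simp
qed

lemma outer_open: "open U \<Longrightarrow> outer U = open_mass U"
  unfolding outer_def by (intro antisym INF_lower INF_greatest) (auto intro: open_mass_mono)

lemma outer_mono: "A \<subseteq> B \<Longrightarrow> outer A \<le> outer B"
  unfolding outer_def by (rule INF_superset_mono) auto

text \<open>A test function \<open>f\<close> for the union need not be subordinate to finitely many of the sets. But the
  sums \<open>\<Sum>i<n. bump (U i) n\<close> increase with \<open>n\<close> and are eventually at least \<open>1\<close> at every point of
  the union, so they exceed \<open>f - e\<close> everywhere from some \<open>n\<close> on, by compactness (the argument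
  of Dini's theorem).\<close>

lemma open_mass_UN_le:
  fixes U :: "nat \<Rightarrow> 'a set"
  assumes U: "\<And>i. open (U i)"
  shows "open_mass (\<Union>i. U i) \<le> (\<Sum>i. open_mass (U i))"
proof -
  have "ennreal (L f) \<le> (\<Sum>i. open_mass (U i))" if f: "f \<in> subordinate (\<Union>i. U i)" for f
  proof (rule ennreal_le_epsilon)
    fix e :: real assume e: "0 < e"
    have cf: "continuous_on UNIV f" using f by (simp add: subordinate_def)
    define V where "V n = {y. f y < e + (\<Sum>i<n. bump (U i) n y)}" for n
    have oV: "open (V n)" for n
      unfolding V_def using cf continuous_bump
      by (intro open_Collect_less continuous_intros) auto
    have Vmono: "V m \<subseteq> V n" if "m \<le> n" for m n
    proof -
      have "(\<Sum>i<m. bump (U i) m y) \<le> (\<Sum>i<n. bump (U i) n y)" for y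
        using that bump_mono[OF that]
        by (intro order_trans[OF sum_mono sum_mono2]) (auto simp: bump_bounds)
      then show ?thesis unfolding V_def by (auto intro: less_le_trans)
    qed
    have cover: "\<exists>n. y \<in> V n" for y
    proof (cases "\<exists>i. y \<in> U i")
      case True
      then obtain i where i: "y \<in> U i" by blast
      have "eventually (\<lambda>n. bump (U i) n y = 1 \<and> i < n) sequentially"
        using eventually_bump_eq_1[OF U i] eventually_gt_at_top[of i] by eventually_elim auto
      then obtain n where n: "bump (U i) n y = 1" "i < n"
        unfolding eventually_sequentially by blast
      have "bump (U i) n y \<le> (\<Sum>j<n. bump (U j) n y)"
        using n by (intro member_le_sum) (auto simp: bump_bounds)
      moreover have "f y \<le> 1" using f by (simp add: subordinate_def)
      ultimately show ?thesis using n e by (auto simp: V_def intro!: exI[of _ n])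
    next
      case False
      then show ?thesis using f e
        by (auto simp: V_def subordinate_def intro!: exI[of _ 0])
    qed
    obtain I where I: "finite I" "UNIV \<subseteq> (\<Union>n\<in>I. V n)"
      by (rule compactE_image[OF compact_UNIV, of UNIV V]) (use oV cover in auto)
    define n where "n = Max (insert 0 I)"
    have "y \<in> V n" for y
    proof -
      obtain k where k: "k \<in> I" "y \<in> V k" using I by auto
      then have "k \<le> n" unfolding n_def using I by (intro Max_ge) auto
      then show ?thesis using Vmono k by blast
    qed
    then have "L f \<le> L (\<lambda>y. e + (\<Sum>i<n. bump (U i) n y))"
      using cf by (intro L_mono continuous_intros) (auto simp: V_def continuous_bump intro: less_imp_le)
    also have "\<dots> = e + (\<Sum>i<n. L (bump (U i) n))"
      by (subst L_add) (auto simp: L_const L_sum continuous_bump intro!: continuous_intros)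
    finally have "ennreal (L f) \<le> ennreal (e + (\<Sum>i<n. L (bump (U i) n)))"
      by (rule ennreal_leI)
    also have "\<dots> = ennreal e + (\<Sum>i<n. ennreal (L (bump (U i) n)))"
      using e L_nonneg[OF continuous_bump bump_bounds(1)]
      by (simp add: ennreal_plus sum_nonneg sum_ennreal)
    also have "\<dots> \<le> ennreal e + (\<Sum>i<n. open_mass (U i))"
      by (intro add_left_mono sum_mono L_le_open_mass bump_subordinate)
    also have "\<dots> \<le> ennreal e + (\<Sum>i. open_mass (U i))"
      by (intro add_left_mono sum_le_suminf) auto
    finally show "ennreal (L f) \<le> (\<Sum>i. open_mass (U i)) + ennreal e"
      by (simp add: add.commute)
  qed
  then show ?thesis unfolding open_mass_def[of "\<Union>i. U i"] by (rule SUP_least)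
qed

lemma outer_UN_le:
  fixes A :: "nat \<Rightarrow> 'a set"
  shows "outer (\<Union>i. A i) \<le> (\<Sum>i. outer (A i))"
proof (rule ennreal_le_epsilon)
  fix e :: real assume e: "0 < e" and fin: "(\<Sum>i. outer (A i)) < top"
  have "\<exists>U. open U \<and> A i \<subseteq> U \<and> open_mass U \<le> outer (A i) + e * (1/2) ^ Suc i" for i
  proof -
    have "outer (A i) \<le> 1"
      unfolding outer_def by (rule INF_lower2[of UNIV]) (auto simp: open_mass_le_1)
    then have "outer (A i) < top" by (simp add: le_less_trans)
    then have "outer (A i) < outer (A i) + e * (1/2) ^ Suc i"
      using e by (cases "outer (A i)" rule: ennreal_cases) (auto simp flip: ennreal_plus simp: ennreal_less_iff)
    then show ?thesis
      unfolding outer_def by (subst (asm) INF_less_iff) (auto intro: less_imp_le)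
  qed
  then obtain U where U: "\<And>i. open (U i)" "\<And>i. A i \<subseteq> U i"
      "\<And>i. open_mass (U i) \<le> outer (A i) + e * (1/2) ^ Suc i"
    by metis
  have "outer (\<Union>i. A i) \<le> open_mass (\<Union>i. U i)"
    using U by (subst outer_open[symmetric]) (auto intro!: outer_mono)
  also have "\<dots> \<le> (\<Sum>i. open_mass (U i))" by (rule open_mass_UN_le) fact
  also have "\<dots> \<le> (\<Sum>i. outer (A i) + ennreal (e * (1/2) ^ Suc i))"
    by (intro suminf_le U) auto
  also have "\<dots> = (\<Sum>i. outer (A i)) + (\<Sum>i. ennreal (e * (1/2) ^ Suc i))"
    by (intro suminf_add[symmetric]) auto
  also have "(\<Sum>i. ennreal (e * (1/2) ^ Suc i)) = ennreal e"
  proof (rule suminf_ennreal_eq)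
    show "(\<lambda>i. e * (1/2) ^ Suc i) sums e"
      using sums_mult[OF power_half_series, of e] by (simp only: mult_1_right)
  qed (use e in auto)
  finally show "outer (\<Union>i. A i) \<le> (\<Sum>i. outer (A i)) + ennreal e" .
qed

lemma outer_empty: "outer {} = 0"
proof -
  have "L f = 0" if "f \<in> subordinate {}" for f
  proof -
    have "f = (\<lambda>_. 0)" using that by (auto simp: subordinate_def)
    then show ?thesis by (simp add: L_const)
  qed
  then have "open_mass {} \<le> 0" unfolding open_mass_def by (intro SUP_least) auto
  then show ?thesis by (simp add: outer_open)
qed

lemma outer_measure_space_outer: "outer_measure_space UNIV outer"
  by (auto simp: outer_measure_space_def positive_def increasing_def countably_subadditive_def
      outer_empty outer_mono outer_UN_le)

lemma outer_Un_le: "outer (A \<union> B) \<le> outer A + outer B"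
proof -
  have "outer (\<Union>i. if i = 0 then A else if i = Suc 0 then B else {})
      \<le> (\<Sum>i. outer (if i = 0 then A else if i = Suc 0 then B else {}))"
    by (rule outer_UN_le)
  also have "\<dots> = (\<Sum>i\<in>{0, Suc 0}. outer (if i = 0 then A else if i = Suc 0 then B else {}))"
    by (rule suminf_finite) (auto simp: outer_empty)
  also have "(\<Union>i::nat. if i = 0 then A else if i = Suc 0 then B else {}) = A \<union> B"
    by (auto split: if_splits) 
  finally show ?thesis by simp
qed

text \<open>Start with a test function \<open>f\<close> for \<open>U \<inter> V\<close>, lower it by \<open>e\<close> and cut it off at \<open>0\<close>. It now vanishes on the open set
  \<open>W = U \<inter> {f < e}\<close>, which contains \<open>U - V\<close>. Hence adding any test function for \<open>W\<close> to it gives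
  a test function for \<open>U\<close>, and the two masses add up.\<close>

lemma open_mass_split:
  assumes U: "open U" and V: "open V"
  shows "outer (U \<inter> V) + outer (U - V) \<le> open_mass U"
proof -
  have *: "ennreal (L f) + outer (U - V) \<le> open_mass U" if f: "f \<in> subordinate (U \<inter> V)" for f
  proof (rule ennreal_le_epsilon)
    fix e :: real assume e: "0 < e"
    have cf: "continuous_on UNIV f" using f by (simp add: subordinate_def)
    define f' where "f' y = max 0 (f y - e)" for y
    have cf': "continuous_on UNIV f'" unfolding f'_def by (intro continuous_intros cf)
    define W where "W = U \<inter> {y. f y < e}"
    have W: "open W"
      unfolding W_def using cf U by (intro open_Int open_Collect_less) auto
    have "U - V \<subseteq> W" using f e by (auto simp: W_def subordinate_def)
    then have 1: "outer (U - V) \<le> open_mass W"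
      by (metis W outer_mono outer_open)
    have 2: "ennreal (L f') + open_mass W \<le> open_mass U"
    proof -
      have "ennreal (L g) + ennreal (L f') \<le> open_mass U" if g: "g \<in> subordinate W" for g
      proof -
        have cg: "continuous_on UNIV g" using g by (simp add: subordinate_def)
        have "(\<lambda>y. g y + f' y) \<in> subordinate U"
        proof -
          have "0 \<le> g y + f' y \<and> g y + f' y \<le> 1 \<and> (y \<notin> U \<longrightarrow> g y + f' y = 0)" for y
          proof (cases "y \<in> W")
            case True
            then have "f' y = 0" by (simp add: W_def f'_def)
            then show ?thesis using g True by (auto simp: subordinate_def W_def)
          next
            case False
            then have "g y = 0" using g by (simp add: subordinate_def)
            moreover have "0 \<le> f y" "f y \<le> 1" "y \<notin> U \<Longrightarrow> f y = 0" using f by (auto simp: subordinate_def)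
            ultimately show ?thesis using e by (auto simp: f'_def)
          qed
          then show ?thesis by (simp add: subordinate_def continuous_on_add cg cf')
        qed
        then have "ennreal (L (\<lambda>y. g y + f' y)) \<le> open_mass U" by (rule L_le_open_mass)
        moreover have "0 \<le> L g" "0 \<le> L f'"
          using g by (auto intro!: L_nonneg cg cf' simp: subordinate_def f'_def)
        ultimately show ?thesis by (simp add: L_add cg cf')
      qed
      moreover have "subordinate W \<noteq> {}" using bump_subordinate by blast
      ultimately show ?thesis
        unfolding open_mass_def[of W] add.commute[of "ennreal (L f')"]
        by (subst ennreal_SUP_add_left[symmetric]) (auto intro!: SUP_least)
    qed
    have "L f \<le> L (\<lambda>y. f' y + e)"
      by (intro L_mono cf continuous_intros cf') (auto simp: f'_def)
    also have "\<dots> = L f' + e" by (simp add: L_add cf' L_const)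
    finally have "ennreal (L f) \<le> ennreal (L f' + e)" by (rule ennreal_leI)
    also have "\<dots> = ennreal (L f') + ennreal e"
      using e by (auto intro!: ennreal_plus L_nonneg cf' simp: f'_def)
    finally have "ennreal (L f) + outer (U - V) \<le> ennreal (L f') + ennreal e + open_mass W"
      using 1 by (rule add_mono)
    also have "\<dots> \<le> open_mass U + ennreal e"
      using 2 by (metis add.assoc add.commute add_right_mono)
    finally show "ennreal (L f) + outer (U - V) \<le> open_mass U + ennreal e" .
  qed
  have "subordinate (U \<inter> V) \<noteq> {}" using bump_subordinate by blast
  then have "open_mass (U \<inter> V) + outer (U - V) \<le> open_mass U"
    using * unfolding open_mass_def[of "U \<inter> V"]
    by (subst ennreal_SUP_add_left[symmetric]) (auto intro!: SUP_least)
  then show ?thesis using U V by (simp add: outer_open open_Int)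
qed

lemma open_in_lambda_system:
  assumes V: "open V"
  shows "V \<in> lambda_system UNIV UNIV outer"
proof -
  have "outer (V \<inter> A) + outer ((UNIV - V) \<inter> A) = outer A" for A
  proof (rule antisym)
    show "outer (V \<inter> A) + outer ((UNIV - V) \<inter> A) \<le> outer A"
      unfolding outer_def[of A]
    proof (rule INF_greatest)
      fix U assume "U \<in> {U. open U \<and> A \<subseteq> U}"
      then have "open U" "A \<subseteq> U" by auto
      then have "outer (V \<inter> A) \<le> outer (U \<inter> V)" "outer ((UNIV - V) \<inter> A) \<le> outer (U - V)"
        by (auto intro!: outer_mono)
      then have "outer (V \<inter> A) + outer ((UNIV - V) \<inter> A) \<le> outer (U \<inter> V) + outer (U - V)"
        by (rule add_mono)
      also have "\<dots> \<le> open_mass U" using open_mass_split[OF \<open>open U\<close> V] .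
      finally show "outer (V \<inter> A) + outer ((UNIV - V) \<inter> A) \<le> open_mass U" .
    qed
    have "A = V \<inter> A \<union> (UNIV - V) \<inter> A" by auto
    then show "outer A \<le> outer (V \<inter> A) + outer ((UNIV - V) \<inter> A)"
      using outer_Un_le by metis
  qed
  then show ?thesis by (simp add: lambda_system_def)
qed

definition rep :: "'a measure" where
  "rep = measure_of UNIV (sets borel) outer"

lemma
  shows sets_rep: "sets rep = sets borel"
    and space_rep: "space rep = UNIV"
    and emeasure_rep: "A \<in> sets borel \<Longrightarrow> emeasure rep A = outer A"
proof -
  have bs: "sets (borel :: 'a measure) = sigma_sets UNIV {S. open S}"
    by (simp add: borel_def)
  show [simp]: "sets rep = sets borel" "space rep = UNIV"
    using sets.sigma_sets_eq[of "borel :: 'a measure"] by (auto simp: rep_def)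
  interpret P: sigma_algebra UNIV "UNIV :: 'a set set"
    by (metis Pow_UNIV sigma_algebra_Pow)
  have ms: "measure_space UNIV (lambda_system UNIV UNIV outer) outer"
    by (rule P.caratheodory_lemma[OF outer_measure_space_outer])
  then have "sigma_sets UNIV {S. open S} \<subseteq> lambda_system UNIV UNIV outer"
    by (intro sigma_algebra.sigma_sets_subset) (auto simp: measure_space_def open_in_lambda_system)
  then have sub: "sets borel \<subseteq> lambda_system UNIV UNIV outer" by (simp add: bs)
  show "emeasure rep A = outer A" if "A \<in> sets borel"
  proof (rule emeasure_measure_of[OF rep_def])
    show "positive (sets rep) outer"
      by (simp add: positive_def outer_empty)
    show "countably_additive (sets rep) outer"
      using ms sub unfolding measure_space_def countably_additive_def by simp blast
  qed (use that in auto)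
qed

lemma emeasure_rep_open: "open U \<Longrightarrow> emeasure rep U = open_mass U"
  by (simp add: emeasure_rep outer_open)

lemma prob_space_rep: "prob_space rep"
proof
  have "(\<lambda>_. 1) \<in> subordinate (UNIV :: 'a set)" by (simp add: subordinate_def)
  from L_le_open_mass[OF this] have "1 \<le> open_mass UNIV" by (simp add: L_one)
  then show "emeasure rep (space rep) = 1"
    using open_mass_le_1[of UNIV] by (simp add: space_rep emeasure_rep_open)
qed

end

lemma integrable_continuous:
  fixes f :: "'a::metric_space \<Rightarrow> 'b::{banach,second_countable_topology}"
  assumes "compact (UNIV :: 'a set)" "finite_measure M" "sets M = sets borel" "continuous_on UNIV f"
  shows "integrable M f"
proof -
  interpret finite_measure M by fact
  have "bounded (range f)"
    using assms(1,4) by (intro compact_imp_bounded compact_continuous_image)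
  then obtain B where "\<And>y. norm (f y) \<le> B" by (auto simp: bounded_iff)
  moreover have "f \<in> borel_measurable M"
    using borel_measurable_continuous_onI[OF assms(4)] measurable_cong_sets[OF assms(3) refl] by blast
  ultimately show ?thesis by (intro integrable_const_bound) auto
qed

text \<open>Slicing a nonnegative number into layers of height \<open>1\<close>.\<close>

lemma clamp_layers:
  fixes t :: real
  assumes "0 \<le> t"
  shows "(\<Sum>k<n. max 0 (min 1 (t - real k))) = min t (real n)"
  using assms by (induction n) (auto simp: min_def max_def)

context mean_functional
begin

text \<open>Slice \<open>n f\<close> into the \<open>n\<close> layers \<open>g k\<close>, each with values in \<open>[0, 1]\<close>. The layer \<open>g k\<close> vanishes
  off \<open>E k = {n f > k}\<close>, so \<open>L (g k)\<close> is at most the mass of \<open>E k\<close>; and it equals \<open>1\<close> on \<open>E (k + 1)\<close>,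
  so its integral is at least the mass of \<open>E (k + 1)\<close>. Summing, the two bounds differ by the
  mass of \<open>E 0\<close> only, an error of at most \<open>1 / n\<close> in \<open>L f\<close>.\<close>

lemma L_le_integral_rep:
  assumes cf: "continuous_on UNIV f" and f: "\<And>y. 0 \<le> f y" "\<And>y. f y \<le> 1"
  shows "L f \<le> (\<integral>y. f y \<partial>rep)"
proof -
  interpret R: prob_space rep by (rule prob_space_rep)
  have fin: "finite_measure rep" by unfold_locales
  note int = integrable_continuous[OF compact_UNIV fin sets_rep]
  have bound: "L f \<le> (\<integral>y. f y \<partial>rep) + inverse (real (Suc m))" for m
  proof -
    define n where "n = Suc m"
    define g where "g k y = max 0 (min 1 (real n * f y - real k))" for k y
    define E where "E k = {y. real k < real n * f y}" for k
    have cg: "continuous_on UNIV (g k)" for k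
      unfolding g_def by (intro continuous_intros cf)
    have oE: "open (E k)" for k
      unfolding E_def by (intro open_Collect_less continuous_intros cf)
    have sum_g: "(\<Sum>k<n. g k y) = real n * f y" for y
      unfolding g_def using f[of y] by (subst clamp_layers) (auto simp: mult_left_le)
    have upper: "L (g k) \<le> measure rep (E k)" for k
    proof -
      have "g k \<in> subordinate (E k)"
        using cg by (auto simp: subordinate_def g_def E_def)
      then have "ennreal (L (g k)) \<le> emeasure rep (E k)"
        using L_le_open_mass oE by (simp add: emeasure_rep_open)
      then show ?thesis by (simp add: R.emeasure_eq_measure)
    qed
    have lower: "measure rep (E (Suc k)) \<le> (\<integral>y. g k y \<partial>rep)" for k
    proof -
      have E: "E (Suc k) \<in> sets rep" using oE by (simp add: sets_rep)
      then have I: "integrable rep (indicator (E (Suc k)) :: 'a \<Rightarrow> real)"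
        by (simp add: R.emeasure_eq_measure)
      have "measure rep (E (Suc k)) = (\<integral>y. indicator (E (Suc k)) y \<partial>rep)" using E by simp
      also have "\<dots> \<le> (\<integral>y. g k y \<partial>rep)"
        by (rule integral_mono[OF I int[OF cg]]) (auto simp: g_def E_def indicator_def)
      finally show ?thesis .
    qed
    have "real n * L f = L (\<lambda>y. \<Sum>k<n. g k y)"
      by (simp add: sum_g L_scale cf)
    also have "\<dots> = (\<Sum>k<n. L (g k))" by (intro L_sum cg) auto
    also have "\<dots> \<le> (\<Sum>k<n. measure rep (E k))" by (intro sum_mono upper)
    also have "\<dots> = measure rep (E 0) + (\<Sum>k<m. measure rep (E (Suc k)))"
      unfolding n_def by (rule sum.lessThan_Suc_shift)
    also have "\<dots> \<le> 1 + (\<Sum>k<m. \<integral>y. g k y \<partial>rep)"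
      by (intro add_mono sum_mono lower R.prob_le_1)
    also have "\<dots> \<le> 1 + (\<Sum>k<n. \<integral>y. g k y \<partial>rep)"
      unfolding n_def by (auto intro!: Bochner_Integration.integral_nonneg simp: g_def)
    also have "(\<Sum>k<n. \<integral>y. g k y \<partial>rep) = (\<integral>y. (\<Sum>k<n. g k y) \<partial>rep)"
      by (intro Bochner_Integration.integral_sum[symmetric] int cg)
    also have "\<dots> = real n * (\<integral>y. f y \<partial>rep)" by (simp add: sum_g)
    finally have "real n * L f \<le> 1 + real n * (\<integral>y. f y \<partial>rep)" .
    then show ?thesis by (simp add: n_def field_simps)
  qed
  show ?thesis
    using bound LIMSEQ_inverse_real_of_nat_add[of "\<integral>y. f y \<partial>rep"]
    by (intro LIMSEQ_le_const[where X = "\<lambda>m. (\<integral>y. f y \<partial>rep) + inverse (real (Suc m))"]) auto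
qed

text \<open>By rescaling, the inequality \<open>L g \<le> \<integral> g\<close> holds for every continuous \<open>g\<close>; used for \<open>f\<close> and for
  \<open>- f\<close> it gives equality.\<close>

theorem riesz_representation:
  assumes cf: "continuous_on UNIV f"
  shows "(\<integral>y. f y \<partial>rep) = L f"
proof -
  interpret R: prob_space rep by (rule prob_space_rep)
  have fin: "finite_measure rep" by unfold_locales
  note int = integrable_continuous[OF compact_UNIV fin sets_rep]
  have le: "L g \<le> (\<integral>y. g y \<partial>rep)" if cg: "continuous_on UNIV g" for g
  proof -
    have "bounded (range g)"
      using compact_UNIV cg by (intro compact_imp_bounded compact_continuous_image)
    then obtain B where B: "0 < B" "\<And>y. \<bar>g y\<bar> \<le> B"
      by (auto simp: bounded_pos)
    define h where "h y = inverse (2 * B) * (g y + B)" for y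
    have ch: "continuous_on UNIV h" unfolding h_def by (intro continuous_intros cg)
    have "0 \<le> h y \<and> h y \<le> 1" for y
      using B(1) B(2)[of y] by (auto simp: h_def field_simps abs_le_iff)
    then have "L h \<le> (\<integral>y. h y \<partial>rep)" by (intro L_le_integral_rep ch) auto
    moreover have "L h = inverse (2 * B) * (L g + B)"
      unfolding h_def using cg by (subst L_scale) (auto intro!: continuous_intros simp: L_add L_const)
    moreover have "(\<integral>y. h y \<partial>rep) = inverse (2 * B) * ((\<integral>y. g y \<partial>rep) + B)"
      unfolding h_def using int[OF cg] R.prob_space by simp
    ultimately show ?thesis using B(1) by simp
  qed
  have "L (\<lambda>y. - f y) = - L f" using L_scale[of f "-1"] cf by simp
  then show ?thesis
    using le[OF cf] le[of "\<lambda>y. - f y"] cf by (simp add: continuous_on_minus)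
qed

end

section \<open>Borel sets and continuous functions\<close>

lemma integral_bump_tendsto:
  assumes "finite_measure M" "sets M = sets borel" "open U"
  shows "(\<lambda>n. \<integral>y. bump U n y \<partial>M) \<longlonglongrightarrow> measure M U"
proof -
  interpret finite_measure M by fact
  have U: "U \<in> sets M" using assms by simp
  have meas: "bump U n \<in> borel_measurable M" for n
    using borel_measurable_continuous_onI[OF continuous_bump] measurable_cong_sets[OF assms(2) refl] by blast
  have "(\<lambda>n. \<integral>y. bump U n y \<partial>M) \<longlonglongrightarrow> (\<integral>y. indicator U y \<partial>M)"
    using U meas
    by (intro integral_dominated_convergence[where w = "\<lambda>_. 1"])
      (auto simp: bump_tendsto_indicator assms(3) bump_bounds abs_of_nonneg)
  then show ?thesis using U by simp
qed

text \<open>The integrals of the bump functions of an open set tend to its measure, and the open sets form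
  an intersection-stable generator.\<close>

lemma borel_measure_eqI_continuous:
  fixes M N :: "'a::metric_space measure"
  assumes M: "finite_measure M" "sets M = sets borel" and N: "finite_measure N" "sets N = sets borel"
    and eq: "\<And>f :: 'a \<Rightarrow> real. continuous_on UNIV f \<Longrightarrow> (\<integral>y. f y \<partial>M) = (\<integral>y. f y \<partial>N)"
  shows "M = N"
proof (rule measure_eqI_generator_eq)
  show "Int_stable {S :: 'a set. open S}" by (auto simp: Int_stable_def)
  show "emeasure M U = emeasure N U" if "U \<in> {S. open S}" for U
  proof -
    have "open U" using that by simp
    then have "(\<lambda>n. \<integral>y. bump U n y \<partial>N) \<longlonglongrightarrow> measure M U"
      using integral_bump_tendsto[OF M] eq[OF continuous_bump] by simp
    then have "measure M U = measure N U"
      using integral_bump_tendsto[OF N \<open>open U\<close>] by (rule LIMSEQ_unique)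
    then show ?thesis
      using M(1) N(1) by (simp add: finite_measure.emeasure_eq_measure)
  qed
  show "sets M = sigma_sets UNIV {S. open S}" "sets N = sigma_sets UNIV {S. open S}"
    using assms by (simp_all add: borel_def)
  show "range (\<lambda>_::nat. UNIV :: 'a set) \<subseteq> {S. open S}" by auto
  show "emeasure M UNIV \<noteq> \<infinity>"
    using M(1) by (simp add: finite_measure.emeasure_eq_measure)
qed auto

text \<open>The sets that can be approximated form a Dynkin system: a complement is approximated by
  \<open>1 - f\<close>, and a disjoint union by the sum of approximations to finitely many members, cut off
  at \<open>1\<close>. Bump functions approximate open sets.\<close>

lemma borel_indicator_L1_approx:
  fixes M :: "'a::metric_space measure"
  assumes "finite_measure M" and sets: "sets M = sets borel" and A: "A \<in> sets borel" and e: "0 < e"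
  shows "\<exists>f :: 'a \<Rightarrow> real. continuous_on UNIV f \<and> (\<forall>y. 0 \<le> f y \<and> f y \<le> 1) \<and> (\<integral>y. \<bar>indicator A y - f y\<bar> \<partial>M) < e"
proof -
  interpret finite_measure M by fact
  have meas: "f \<in> borel_measurable M" if "continuous_on UNIV f" for f :: "'a \<Rightarrow> real"
    using borel_measurable_continuous_onI[OF that] measurable_cong_sets[OF sets refl] by blast
  have bs: "sets (borel :: 'a measure) = sigma_sets UNIV {S. open S}"
    by (simp add: borel_def)
  have int: "integrable M (\<lambda>y. \<bar>indicator A y - f y\<bar>)"
    if "A \<in> sets borel" "continuous_on UNIV f" "\<forall>y. 0 \<le> f y \<and> f y \<le> 1" for A and f :: "'a \<Rightarrow> real"
    using that meas sets
    by (intro integrable_const_bound[where B = 1]) (auto simp: indicator_def)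
  have "Int_stable {S :: 'a set. open S}" "{S :: 'a set. open S} \<subseteq> Pow UNIV"
    by (auto simp: Int_stable_def)
  moreover have "A \<in> sigma_sets UNIV {S. open S}" using A bs by simp
  ultimately have "\<forall>e>0. \<exists>f :: 'a \<Rightarrow> real. continuous_on UNIV f \<and> (\<forall>y. 0 \<le> f y \<and> f y \<le> 1) \<and> (\<integral>y. \<bar>indicator A y - f y\<bar> \<partial>M) < e"
  proof (induction rule: sigma_sets_induct_disjoint)
    case (basic U)
    then have U: "open U" by simp
    have "U \<in> sets M" using U sets by simp
    have "(\<lambda>n. \<integral>y. \<bar>indicator U y - bump U n y\<bar> \<partial>M) \<longlonglongrightarrow> (\<integral>y. 0 \<partial>M)"
    proof (rule integral_dominated_convergence[where w = "\<lambda>_. 1"])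
      show "AE y in M. (\<lambda>n. \<bar>indicator U y - bump U n y\<bar>) \<longlonglongrightarrow> 0"
      proof (rule AE_I2)
        fix y
        show "(\<lambda>n. \<bar>indicator U y - bump U n y\<bar>) \<longlonglongrightarrow> 0"
          using tendsto_rabs[OF tendsto_diff[OF tendsto_const bump_tendsto_indicator[OF U]], of "indicator U y" y]
          by simp
      qed
      show "AE y in M. norm \<bar>indicator U y - bump U n y\<bar> \<le> 1" for n
      proof (rule AE_I2)
        fix y
        show "norm \<bar>indicator U y - bump U n y\<bar> \<le> 1"
          using bump_bounds[of U n y] by (auto simp: indicator_def)
      qed
    qed (use meas[OF continuous_bump] \<open>U \<in> sets M\<close> in auto)
    then have "eventually (\<lambda>n. (\<integral>y. \<bar>indicator U y - bump U n y\<bar> \<partial>M) < e) sequentially" if "e > 0" for e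
      using that by (auto intro: order_tendstoD)
    then have "\<exists>n. (\<integral>y. \<bar>indicator U y - bump U n y\<bar> \<partial>M) < e" if "e > 0" for e
      using that unfolding eventually_sequentially by blast
    moreover have "continuous_on UNIV (bump U n) \<and> (\<forall>y. 0 \<le> bump U n y \<and> bump U n y \<le> 1)" for n
      by (simp add: continuous_bump bump_bounds)
    ultimately show ?case by blast
  next
    case empty
    then show ?case by (auto intro!: exI[of _ "\<lambda>_. 0"])
  next
    case (compl A)
    show ?case
    proof (intro allI impI)
      fix e :: real assume "0 < e"
      then obtain f where f: "continuous_on UNIV f" "\<forall>y. 0 \<le> f y \<and> f y \<le> 1"
        "(\<integral>y. \<bar>indicator A y - f y\<bar> \<partial>M) < e" using compl by blast
      have "\<bar>indicator (UNIV - A) y - (1 - f y)\<bar> = \<bar>indicator A y - f y\<bar>" for y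
        by (auto simp: indicator_def)
      then show "\<exists>f :: 'a \<Rightarrow> real. continuous_on UNIV f \<and> (\<forall>y. 0 \<le> f y \<and> f y \<le> 1) \<and> (\<integral>y. \<bar>indicator (UNIV - A) y - f y\<bar> \<partial>M) < e"
        using f by (intro exI[of _ "\<lambda>y. 1 - f y"]) (auto intro!: continuous_intros)
    qed
  next
    case (union A)
    have Ab: "A i \<in> sets borel" for i using union(2) bs by auto
    show ?case
    proof (intro allI impI)
      fix e :: real assume e: "0 < e"
      define B where "B n = (\<Union>i<n. A i)" for n
      define U where "U = (\<Union>i. A i)"
      have BU: "B n \<in> sets M" "U \<in> sets M" "B n \<subseteq> U" for n
        using Ab sets by (auto simp: B_def U_def)
      have "(\<lambda>n. measure M (B n)) \<longlonglongrightarrow> measure M (\<Union>n. B n)"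
      proof (rule finite_Lim_measure_incseq)
        show "incseq B" unfolding B_def incseq_def by (intro allI impI UN_mono) auto
      qed (use BU in auto)
      also have "(\<Union>n. B n) = U" by (auto simp: B_def U_def)
      finally have "eventually (\<lambda>n. measure M U - e / 2 < measure M (B n)) sequentially"
        using e by (intro order_tendstoD) auto
      then obtain n where n: "measure M U - e / 2 < measure M (B n)"
        unfolding eventually_sequentially by blast
      define d where "d = e / (2 * real (Suc n))"
      have "d > 0" using e by (simp add: d_def)
      then have "\<forall>i. \<exists>f :: 'a \<Rightarrow> real. continuous_on UNIV f \<and> (\<forall>y. 0 \<le> f y \<and> f y \<le> 1) \<and> (\<integral>y. \<bar>indicator (A i) y - f y\<bar> \<partial>M) < d"
        using union(3) by blast
      then obtain f :: "nat \<Rightarrow> 'a \<Rightarrow> real" where "\<forall>i. continuous_on UNIV (f i) \<and> (\<forall>y. 0 \<le> f i y \<and> f i y \<le> 1) \<and> (\<integral>y. \<bar>indicator (A i) y - f i y\<bar> \<partial>M) < d"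
        by (rule choice[THEN exE])
      then have f: "\<And>i. continuous_on UNIV (f i)" "\<And>i y. 0 \<le> f i y \<and> f i y \<le> 1"
        "\<And>i. (\<integral>y. \<bar>indicator (A i) y - f i y\<bar> \<partial>M) < d" by auto
      define g where "g y = min 1 (\<Sum>i<n. f i y)" for y
      have cg: "continuous_on UNIV g" unfolding g_def by (intro continuous_intros f)
      have g01: "\<forall>y. 0 \<le> g y \<and> g y \<le> 1" using f(2) by (auto simp: g_def sum_nonneg)
      have ind: "indicator (B n) y = (\<Sum>i<n. indicator (A i) y :: real)" for y
        unfolding B_def using union(1)
        by (intro indicator_UN_disjoint) (auto simp: disjoint_family_on_def)
      have pt: "\<bar>indicator U y - g y\<bar> \<le> indicator (U - B n) y + (\<Sum>i<n. \<bar>indicator (A i) y - f i y\<bar>)" for y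
      proof -
        have "\<bar>indicator (B n) y - g y\<bar> \<le> \<bar>indicator (B n) y - (\<Sum>i<n. f i y)\<bar>"
          unfolding g_def by (auto simp: indicator_def)
        also have "\<dots> = \<bar>\<Sum>i<n. indicator (A i) y - f i y\<bar>" by (simp add: ind sum_subtractf)
        also have "\<dots> \<le> (\<Sum>i<n. \<bar>indicator (A i) y - f i y\<bar>)" by (rule sum_abs)
        finally show ?thesis
          using BU(3)[of n] by (cases "y \<in> U"; cases "y \<in> B n") auto
      qed
      have "(\<integral>y. \<bar>indicator U y - g y\<bar> \<partial>M)
          \<le> (\<integral>y. indicator (U - B n) y + (\<Sum>i<n. \<bar>indicator (A i) y - f i y\<bar>) \<partial>M)"
      proof (rule integral_mono[OF _ _ pt])
        show "integrable M (\<lambda>y. \<bar>indicator U y - g y\<bar>)"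
          using BU sets by (intro int cg g01) auto
        show "integrable M (\<lambda>y. indicator (U - B n) y + (\<Sum>i<n. \<bar>indicator (A i) y - f i y\<bar>))"
          using BU f Ab by (intro Bochner_Integration.integrable_add Bochner_Integration.integrable_sum int)
            (auto simp: emeasure_eq_measure)
      qed
      also have "\<dots> = measure M (U - B n) + (\<Sum>i<n. \<integral>y. \<bar>indicator (A i) y - f i y\<bar> \<partial>M)"
        using BU(1,3)[of n] BU(2) f Ab
        by (subst Bochner_Integration.integral_add)
          (auto intro!: Bochner_Integration.integrable_sum int Bochner_Integration.integral_sum simp: emeasure_eq_measure)
      also have "measure M (U - B n) < e / 2"
        using n BU by (subst finite_measure_Diff) auto
      also have "(\<Sum>i<n. \<integral>y. \<bar>indicator (A i) y - f i y\<bar> \<partial>M) \<le> real n * d"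
        using sum_bounded_above[of "{..<n}" "\<lambda>i. \<integral>y. \<bar>indicator (A i) y - f i y\<bar> \<partial>M" d] f(3)
        by (simp add: less_imp_le)
      also have "real n * d \<le> e / 2" using e by (simp add: d_def field_simps)
      finally have "(\<integral>y. \<bar>indicator (\<Union>i. A i) y - g y\<bar> \<partial>M) < e" by (simp add: U_def)
      then show "\<exists>f :: 'a \<Rightarrow> real. continuous_on UNIV f \<and> (\<forall>y. 0 \<le> f y \<and> f y \<le> 1) \<and> (\<integral>y. \<bar>indicator (\<Union>i. A i) y - f y\<bar> \<partial>M) < e"
        using cg g01 by blast
    qed
  qed
  then show ?thesis using e by blast
qed

section \<open>Invariant measures\<close>

lemma continuous_on_funpow:
  fixes T :: "'a::topological_space \<Rightarrow> 'a"
  assumes "continuous_on UNIV T"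
  shows "continuous_on UNIV (T ^^ n)"
proof (induction n)
  case (Suc n)
  then show ?case
    unfolding funpow_Suc_right
    by (intro continuous_on_compose assms continuous_on_subset[OF Suc]) simp
qed (simp add: id_def)

lemma borel_measurable_funpow:
  fixes f :: "'a::topological_space \<Rightarrow> real" and T :: "'a \<Rightarrow> 'a"
  assumes "continuous_on UNIV T" "f \<in> borel_measurable borel"
  shows "(\<lambda>y. f ((T ^^ n) y)) \<in> borel_measurable borel"
  using measurable_compose[OF borel_measurable_continuous_onI[OF continuous_on_funpow[OF assms(1)]] assms(2)] .

lemma measurable_invariant_prob:
  "invariant_prob T \<mu> \<Longrightarrow> borel_measurable \<mu> = borel_measurable borel"
  by (auto simp: invariant_prob_def cong: measurable_cong_sets)

lemma integrable_bounded:
  fixes f :: "'a::metric_space \<Rightarrow> real"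
  assumes "invariant_prob T \<mu>" "f \<in> borel_measurable borel" "\<And>y. \<bar>f y\<bar> \<le> c"
  shows "integrable \<mu> f"
proof -
  interpret prob_space \<mu> using assms(1) by (simp add: invariant_prob_def)
  show ?thesis
    using assms measurable_invariant_prob[OF assms(1)]
    by (intro integrable_const_bound[where B = c]) auto
qed

lemma invariant_integral:
  fixes f :: "'a::metric_space \<Rightarrow> real"
  assumes inv: "invariant_prob T \<mu>" and cT: "continuous_on UNIV T"
    and f: "f \<in> borel_measurable borel"
  shows "(\<integral>y. f ((T ^^ n) y) \<partial>\<mu>) = (\<integral>y. f y \<partial>\<mu>)"
proof -
  interpret prob_space \<mu> using inv by (simp add: invariant_prob_def)
  have sets: "sets \<mu> = sets borel" using inv by (simp add: invariant_prob_def)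
  then have space: "space \<mu> = UNIV" by (metis sets_eq_imp_space_eq space_borel)
  have T: "T \<in> measurable \<mu> \<mu>"
    using borel_measurable_continuous_onI[OF cT] measurable_cong_sets[OF sets sets] by blast
  have distr: "distr \<mu> \<mu> T = \<mu>"
  proof (rule measure_eqI)
    fix A assume "A \<in> sets (distr \<mu> \<mu> T)"
    then show "emeasure (distr \<mu> \<mu> T) A = emeasure \<mu> A"
      using inv T sets space
      by (simp add: emeasure_distr emeasure_eq_measure invariant_prob_def)
  qed simp
  have step: "(\<integral>y. g (T y) \<partial>\<mu>) = (\<integral>y. g y \<partial>\<mu>)" if "g \<in> borel_measurable borel" for g :: "'a \<Rightarrow> real"
    using integral_distr[OF T, of g] that unfolding distr measurable_invariant_prob[OF inv] by simp
  show ?thesis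
  proof (induction n)
    case (Suc n)
    have "(\<integral>y. f ((T ^^ Suc n) y) \<partial>\<mu>) = (\<integral>y. f ((T ^^ n) (T y)) \<partial>\<mu>)"
      by (simp add: funpow_swap1)
    also have "\<dots> = (\<integral>y. f ((T ^^ n) y) \<partial>\<mu>)"
      by (rule step) (rule borel_measurable_funpow[OF cT f])
    finally show ?case using Suc by simp
  qed simp
qed

section \<open>The ergodic theorem\<close>

text \<open>The maximum of the orbit sums of length \<open>0, ..., n\<close>. The recursion holds because a nonempty orbit
  sum at \<open>y\<close> is \<open>f y\<close> plus an orbit sum at \<open>T y\<close> that is one term shorter.\<close>

primrec max_orbit_sum :: "('a \<Rightarrow> 'a) \<Rightarrow> ('a \<Rightarrow> real) \<Rightarrow> nat \<Rightarrow> 'a \<Rightarrow> real" where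
  "max_orbit_sum T f 0 y = 0"
| "max_orbit_sum T f (Suc n) y = max 0 (f y + max_orbit_sum T f n (T y))"

lemma orbit_sum_Suc:
  fixes f :: "'a \<Rightarrow> real"
  shows "(\<Sum>j<Suc n. f ((T ^^ j) y)) = f y + (\<Sum>j<n. f ((T ^^ j) (T y)))"
  by (subst sum.lessThan_Suc_shift) (simp add: funpow_swap1)

lemma orbit_sum_le_max: "(\<Sum>j<n. f ((T ^^ j) y)) \<le> max_orbit_sum T f n y"
proof (induction n arbitrary: y)
  case (Suc n)
  show ?case using Suc[of "T y"] unfolding orbit_sum_Suc by simp
qed simp

lemma max_orbit_sum_nonneg: "0 \<le> max_orbit_sum T f n y"
  by (cases n) auto

lemma max_orbit_sum_le_Suc: "max_orbit_sum T f n y \<le> max_orbit_sum T f (Suc n) y"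
proof (induction n arbitrary: y)
  case (Suc n)
  show ?case using Suc[of "T y"] by (auto simp: max_def)
qed simp

lemma max_orbit_sum_bound:
  assumes "\<And>y. \<bar>f y\<bar> \<le> c"
  shows "max_orbit_sum T f n y \<le> real n * c"
proof (induction n arbitrary: y)
  case (Suc n)
  have "0 \<le> c" using assms[of y] by linarith
  moreover have "f y \<le> c" using assms[of y] by linarith
  ultimately show ?case using Suc[of "T y"] by (simp add: algebra_simps)
qed simp

lemma max_orbit_sum_measurable:
  fixes f :: "'a::metric_space \<Rightarrow> real"
  assumes "continuous_on UNIV T" "f \<in> borel_measurable borel"
  shows "max_orbit_sum T f n \<in> borel_measurable borel"
proof (induction n)
  case (Suc n)
  have "(\<lambda>y. max_orbit_sum T f n (T y)) \<in> borel_measurable borel"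
    using borel_measurable_funpow[OF assms(1) Suc, of 1] by simp
  then have "(\<lambda>y. max 0 (f y + max_orbit_sum T f n (T y))) \<in> borel_measurable borel"
    using assms(2) by measurable
  then show ?case by simp
next
  case 0
  have "max_orbit_sum T f 0 = (\<lambda>_. 0)" by auto
  then show ?case by simp
qed

text \<open>Garsia's argument. Where the maximal sum \<open>M n\<close> is positive it is at most
  \<open>M (n + 1) = f + M n \<circ> T\<close>; elsewhere it is \<open>0 \<le> M n \<circ> T\<close>. So \<open>f\<close>, restricted to \<open>{M n > 0}\<close>, is at
  least \<open>M n - M n \<circ> T\<close>, whose integral is \<open>0\<close> by invariance. The sets \<open>{M n > 0}\<close> increase to a set
  of full measure.\<close>

lemma maximal_ergodic:
  fixes f :: "'a::metric_space \<Rightarrow> real"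
  assumes inv: "invariant_prob T \<mu>" and cT: "continuous_on UNIV T"
    and f: "f \<in> borel_measurable borel" and c: "\<And>y. \<bar>f y\<bar> \<le> c"
    and pos: "AE y in \<mu>. \<exists>n. 0 < (\<Sum>j<n. f ((T ^^ j) y))"
  shows "0 \<le> (\<integral>y. f y \<partial>\<mu>)"
proof -
  interpret prob_space \<mu> using inv by (simp add: invariant_prob_def)
  define M where "M = max_orbit_sum T f"
  define E where "E n = {y. 0 < M n y}" for n
  have M[measurable]: "M n \<in> borel_measurable borel" for n
    unfolding M_def by (rule max_orbit_sum_measurable[OF cT f])
  have E: "E n \<in> sets borel" for n
    unfolding E_def using M[of n] by measurable
  have indE: "(\<lambda>y. indicator (E n) y * f y) \<in> borel_measurable borel" for n
    using f E by measurable
  have bE: "\<bar>indicator (E n) y * f y\<bar> \<le> c" for n y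
    using c[of y] by (auto simp: indicator_def intro: order_trans[OF abs_ge_zero])
  have Mb: "\<bar>M n y\<bar> \<le> real n * c" for n y
    using max_orbit_sum_nonneg[of T f n y] max_orbit_sum_bound[OF c, where T = T and n = n and y = y] by (simp add: M_def)
  have MT: "(\<lambda>y. M n (T y)) \<in> borel_measurable borel" for n
    using borel_measurable_funpow[OF cT M[of n], of 1] by simp
  have "0 \<le> (\<integral>y. indicator (E n) y * f y \<partial>\<mu>)" for n
  proof -
    have "M n y - M n (T y) \<le> indicator (E n) y * f y" for y
    proof (cases "y \<in> E n")
      case True
      then have "0 < max_orbit_sum T f (Suc n) y"
        using max_orbit_sum_le_Suc[of T f n y] by (simp add: E_def M_def)
      then show ?thesis
        using True max_orbit_sum_le_Suc[of T f n y] by (simp add: M_def max_def split: if_splits)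
    next
      case False
      then show ?thesis
        using max_orbit_sum_nonneg[of T f n y] max_orbit_sum_nonneg[of T f n "T y"]
        by (simp add: E_def M_def)
    qed
    then have "(\<integral>y. M n y - M n (T y) \<partial>\<mu>) \<le> (\<integral>y. indicator (E n) y * f y \<partial>\<mu>)"
      by (intro integral_mono Bochner_Integration.integrable_diff
          integrable_bounded[OF inv M Mb] integrable_bounded[OF inv MT Mb] integrable_bounded[OF inv indE bE])
    moreover have "(\<integral>y. M n y - M n (T y) \<partial>\<mu>) = 0"
      using invariant_integral[OF inv cT M, of n 1]
      by (subst Bochner_Integration.integral_diff)
        (auto intro!: integrable_bounded[OF inv M Mb] integrable_bounded[OF inv MT Mb])
    ultimately show ?thesis by simp
  qed
  moreover have "(\<lambda>n. \<integral>y. indicator (E n) y * f y \<partial>\<mu>) \<longlonglongrightarrow> (\<integral>y. f y \<partial>\<mu>)"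
  proof (rule integral_dominated_convergence[where w = "\<lambda>_. c"])
    show "AE y in \<mu>. (\<lambda>n. indicator (E n) y * f y) \<longlonglongrightarrow> f y"
      using pos
    proof eventually_elim
      case (elim y)
      then obtain k where k: "0 < (\<Sum>j<k. f ((T ^^ j) y))" by blast
      have "y \<in> E n" if "k \<le> n" for n
      proof -
        have "M k y \<le> M n y"
          unfolding M_def using max_orbit_sum_le_Suc by (rule lift_Suc_mono_le) (rule that)
        then show ?thesis
          using k orbit_sum_le_max[where T = T and f = f and n = k and y = y] by (simp add: E_def M_def)
      qed
      then have "eventually (\<lambda>n. indicator (E n) y * f y = f y) sequentially"
        by (auto simp: eventually_sequentially intro!: exI[of _ k])
      then show ?case by (rule tendsto_eventually)
    qed
    show "AE y in \<mu>. norm (indicator (E n) y * f y) \<le> c" for n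
      using bE by auto
  qed (use f indE measurable_invariant_prob[OF inv] in auto)
  ultimately show ?thesis by (intro LIMSEQ_le_const) auto
qed

text \<open>The set \<open>E\<close> where the upper limit of the averages exceeds \<open>r\<close> is exactly invariant, so by
  ergodicity it has measure \<open>0\<close> or \<open>1\<close>. If it had measure \<open>1\<close>, almost every orbit would have a
  positive sum of \<open>g - r\<close>, and the maximal inequality would give \<open>\<integral> g \<ge> r\<close>.\<close>

lemma ergodic_limsup_le:
  fixes g :: "'a::metric_space \<Rightarrow> real"
  assumes inv: "invariant_prob T \<mu>" and erg: "ergodic T \<mu>" and cT: "continuous_on UNIV T"
    and g: "g \<in> borel_measurable borel" and c: "\<And>y. \<bar>g y\<bar> \<le> c"
    and r: "(\<integral>y. g y \<partial>\<mu>) < r"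
  shows "AE y in \<mu>. limsup (\<lambda>n. ereal ((\<Sum>j<n. g ((T ^^ j) y)) / real n)) \<le> ereal r"
proof -
  interpret prob_space \<mu> using inv by (simp add: invariant_prob_def)
  have sets: "sets \<mu> = sets borel" using inv by (simp add: invariant_prob_def)
  then have space: "space \<mu> = UNIV" by (metis sets_eq_imp_space_eq space_borel)
  define A where "A n y = (\<Sum>j<n. g ((T ^^ j) y)) / real n" for n y
  define E where "E = {y. ereal r < limsup (\<lambda>n. ereal (A n y))}"
  have [measurable]: "A n \<in> borel_measurable borel" for n
    unfolding A_def using borel_measurable_funpow[OF cT g] by measurable
  have E: "E \<in> sets borel" unfolding E_def by measurable
  have shift: "limsup (\<lambda>n. ereal (A n (T y))) = limsup (\<lambda>n. ereal (A n y))" for y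
  proof -
    have diff: "A n (T y) - A n y = (g ((T ^^ n) y) - g y) / real n" for n
    proof -
      have "(\<Sum>j<n. g ((T ^^ j) (T y))) - (\<Sum>j<n. g ((T ^^ j) y)) = g ((T ^^ n) y) - g y"
        using orbit_sum_Suc[of g T y n] by simp
      then show ?thesis by (simp add: A_def diff_divide_distrib[symmetric])
    qed
    have "(\<lambda>n. A n (T y) - A n y) \<longlonglongrightarrow> 0"
    proof (rule Lim_null_comparison[where g = "\<lambda>n. 2 * c / real n"])
      show "\<forall>\<^sub>F n in sequentially. norm (A n (T y) - A n y) \<le> 2 * c / real n"
      proof (rule always_eventually, rule allI)
        fix n
        have "\<bar>g ((T ^^ n) y) - g y\<bar> \<le> 2 * c"
          using c[of y] c[of "(T ^^ n) y"] by linarith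
        then show "norm (A n (T y) - A n y) \<le> 2 * c / real n"
          unfolding diff by (simp add: divide_right_mono)
      qed
      show "(\<lambda>n. 2 * c / real n) \<longlonglongrightarrow> 0" by (rule lim_const_over_n)
    qed
    then have "(\<lambda>n. ereal (A n (T y) - A n y)) \<longlonglongrightarrow> 0"
      by (simp add: zero_ereal_def)
    then have "limsup (\<lambda>n. ereal (A n (T y) - A n y) + ereal (A n y)) = 0 + limsup (\<lambda>n. ereal (A n y))"
      by (rule ereal_limsup_lim_add) simp
    then show ?thesis by simp
  qed
  have "T -` E = E" by (auto simp: E_def shift)
  then have "measure \<mu> E = 0 \<or> measure \<mu> E = 1"
    using erg E by (auto simp: ergodic_def)
  moreover have "measure \<mu> E \<noteq> 1"
  proof
    assume "measure \<mu> E = 1"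
    then have "AE y in \<mu>. y \<in> E" using E sets by (simp add: prob_eq_1)
    then have "AE y in \<mu>. \<exists>n. 0 < (\<Sum>j<n. g ((T ^^ j) y) - r)"
    proof eventually_elim
      case (elim y)
      then have "ereal r < limsup (\<lambda>n. ereal (A n y))" by (simp add: E_def)
      then obtain s where s: "ereal r < ereal s" "ereal s < limsup (\<lambda>n. ereal (A n y))"
        using ereal_dense2 by blast
      have "\<exists>n\<ge>1. r < A n y"
      proof (rule ccontr)
        assume "\<not> (\<exists>n\<ge>1. r < A n y)"
        then have "eventually (\<lambda>n. ereal (A n y) \<le> ereal r) sequentially"
          by (intro eventually_sequentiallyI[of 1]) (auto simp: not_less)
        then have "limsup (\<lambda>n. ereal (A n y)) \<le> ereal r" by (rule Limsup_bounded)
        then show False using less_trans[OF s] by (simp add: leD)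
      qed
      then obtain n where "1 \<le> n" "r < A n y" by blast
      then have "0 < (\<Sum>j<n. g ((T ^^ j) y) - r)"
        by (simp add: A_def sum_subtractf field_simps)
      then show ?case by blast
    qed
    then have "0 \<le> (\<integral>y. g y - r \<partial>\<mu>)"
    proof (rule maximal_ergodic[OF inv cT, where c = "c + \<bar>r\<bar>", rotated 2])
      show "(\<lambda>y. g y - r) \<in> borel_measurable borel" using g by simp
      show "\<bar>g y - r\<bar> \<le> c + \<bar>r\<bar>" for y using c[of y] by linarith
    qed
    then show False
      using r prob_space integrable_bounded[OF inv g c] by simp
  qed
  ultimately have "measure \<mu> E = 0" by simp
  then have "AE y in \<mu>. y \<notin> E" using E sets by (simp add: prob_eq_0)
  then show ?thesis by eventually_elim (auto simp: E_def A_def)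
qed

text \<open>The preceding bound for \<open>g\<close> and for \<open>- g\<close>, with \<open>r\<close> above the integral by \<open>1 / (k + 1)\<close>.\<close>

theorem ergodic_birkhoff:
  fixes g :: "'a::metric_space \<Rightarrow> real"
  assumes inv: "invariant_prob T \<mu>" and erg: "ergodic T \<mu>" and cT: "continuous_on UNIV T"
    and g: "g \<in> borel_measurable borel" and c: "\<And>y. \<bar>g y\<bar> \<le> c"
  shows "AE y in \<mu>. (\<lambda>n. (\<Sum>j<n. g ((T ^^ j) y)) / real n) \<longlonglongrightarrow> (\<integral>y. g y \<partial>\<mu>)"
proof -
  define I where "I = (\<integral>y. g y \<partial>\<mu>)"
  have upper: "AE y in \<mu>. \<forall>k. limsup (\<lambda>n. ereal ((\<Sum>j<n. h ((T ^^ j) y)) / real n)) \<le> ereal ((\<integral>y. h y \<partial>\<mu>) + inverse (real (Suc k)))"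
    if "h \<in> borel_measurable borel" "\<And>y. \<bar>h y\<bar> \<le> c" for h
    unfolding AE_all_countable using that by (intro allI ergodic_limsup_le[OF inv erg cT]) auto
  have "AE y in \<mu>. \<forall>k. limsup (\<lambda>n. ereal ((\<Sum>j<n. - g ((T ^^ j) y)) / real n)) \<le> ereal (- I + inverse (real (Suc k)))"
    using upper[of "\<lambda>y. - g y"] g c by (simp add: I_def)
  with upper[OF g c] show ?thesis
  proof eventually_elim
    case (elim y)
    show ?case unfolding I_def[symmetric]
    proof (rule tendstoI)
      fix e :: real assume "0 < e"
      then obtain k where k: "inverse (real (Suc k)) < e" using reals_Archimedean by blast
      have "limsup (\<lambda>n. ereal ((\<Sum>j<n. g ((T ^^ j) y)) / real n)) < ereal (I + e)"
        using elim(1)[rule_format, of k] k by (auto simp: I_def intro: le_less_trans)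
      then have 1: "\<forall>\<^sub>F n in sequentially. ereal ((\<Sum>j<n. g ((T ^^ j) y)) / real n) < ereal (I + e)"
        by (rule Limsup_lessD)
      have "limsup (\<lambda>n. ereal ((\<Sum>j<n. - g ((T ^^ j) y)) / real n)) < ereal (- I + e)"
        using elim(2)[rule_format, of k] k by (auto intro: le_less_trans)
      then have 2: "\<forall>\<^sub>F n in sequentially. ereal ((\<Sum>j<n. - g ((T ^^ j) y)) / real n) < ereal (- I + e)"
        by (rule Limsup_lessD)
      show "\<forall>\<^sub>F n in sequentially. dist ((\<Sum>j<n. g ((T ^^ j) y)) / real n) I < e"
        using 1 2 by eventually_elim (auto simp: dist_real_def sum_negf)
    qed
  qed
qed

section \<open>Averages of correlations\<close>

text \<open>The two families of index sets that matter are \<open>{N}\<close>, which gives ordinary convergence to \<open>0\<close>,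
  and \<open>{..<Suc N}\<close>, which gives convergence of the Cesaro means. Treating a general family lets
  one argument serve both mixing and ergodicity.\<close>

definition means_vanish :: "(nat \<Rightarrow> nat set) \<Rightarrow> (nat \<Rightarrow> real) \<Rightarrow> bool" where
  "means_vanish S a \<longleftrightarrow> (\<lambda>N. (\<Sum>n\<in>S N. a n) / real (card (S N))) \<longlonglongrightarrow> 0"

definition averaging :: "(nat \<Rightarrow> nat set) \<Rightarrow> bool" where
  "averaging S \<longleftrightarrow> (\<forall>N. finite (S N) \<and> S N \<noteq> {})"

lemma mean_abs_le:
  fixes a :: "'i \<Rightarrow> real"
  assumes "finite S" "S \<noteq> {}" "\<And>n. n \<in> S \<Longrightarrow> \<bar>a n\<bar> \<le> e"
  shows "\<bar>(\<Sum>n\<in>S. a n) / real (card S)\<bar> \<le> e"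
proof -
  have "\<bar>\<Sum>n\<in>S. a n\<bar> \<le> (\<Sum>n\<in>S. \<bar>a n\<bar>)" by (rule sum_abs)
  also have "\<dots> \<le> real (card S) * e" using assms(3) by (rule sum_bounded_above)
  finally show ?thesis
    using assms(1,2) by (simp add: abs_divide divide_le_eq card_gt_0_iff mult.commute)
qed

text \<open>A mean over a finite set moves by at most the uniform distance between the sequences. This is
  the step that lets the limit measure inherit decay of correlations.\<close>

lemma means_vanish_uniform_limit:
  assumes S: "averaging S"
    and approx: "\<And>e. 0 < e \<Longrightarrow> \<exists>b. means_vanish S b \<and> (\<forall>n. \<bar>a n - b n\<bar> \<le> e)"
  shows "means_vanish S a"
  unfolding means_vanish_def
proof (rule tendstoI)
  fix e :: real assume "0 < e"
  then obtain b where b: "means_vanish S b" "\<And>n. \<bar>a n - b n\<bar> \<le> e / 2"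
    using approx[of "e / 2"] by auto
  have "\<forall>\<^sub>F N in sequentially. dist ((\<Sum>n\<in>S N. b n) / real (card (S N))) 0 < e / 2"
    using b(1) \<open>0 < e\<close> unfolding means_vanish_def by (intro tendstoD) auto
  then show "\<forall>\<^sub>F N in sequentially. dist ((\<Sum>n\<in>S N. a n) / real (card (S N))) 0 < e"
  proof eventually_elim
    case (elim N)
    have "\<bar>(\<Sum>n\<in>S N. a n - b n) / real (card (S N))\<bar> \<le> e / 2"
      using S b(2) by (intro mean_abs_le) (auto simp: averaging_def)
    then show ?case
      using elim unfolding dist_real_def sum_subtractf diff_divide_distrib by linarith
  qed
qed

lemma means_vanish_mean:
  assumes "\<And>k. k < p \<Longrightarrow> means_vanish S (a k)"
  shows "means_vanish S (\<lambda>n. (\<Sum>k<p. a k n) / real p)"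
proof -
  have "(\<Sum>n\<in>S N. (\<Sum>k<p. a k n) / real p) / real (card (S N))
      = (\<Sum>k<p. (\<Sum>n\<in>S N. a k n) / real (card (S N))) / real p" for N
    by (simp add: sum_divide_distrib[symmetric] sum.swap[of _ "S N"] divide_divide_eq_left mult.commute)
  moreover have "(\<lambda>N. (\<Sum>k<p. (\<Sum>n\<in>S N. a k n) / real (card (S N))) / real p) \<longlonglongrightarrow> 0 / real p"
    using assms unfolding means_vanish_def divide_inverse[of _ "real p"]
    by (intro tendsto_mult_right tendsto_null_sum) auto
  ultimately show ?thesis by (simp add: means_vanish_def)
qed

lemma mult_diff_le:
  fixes a b a' b' :: real
  assumes "0 \<le> a'" "a' \<le> 1" "0 \<le> b" "b \<le> 1"
  shows "\<bar>a * b - a' * b'\<bar> \<le> \<bar>a - a'\<bar> + \<bar>b - b'\<bar>"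
proof -
  have "a * b - a' * b' = (a - a') * b + a' * (b - b')" by (simp add: algebra_simps)
  also have "\<bar>\<dots>\<bar> \<le> \<bar>a - a'\<bar> * b + a' * \<bar>b - b'\<bar>"
    using assms by (intro order_trans[OF abs_triangle_ineq]) (simp add: abs_mult)
  also have "\<dots> \<le> \<bar>a - a'\<bar> + \<bar>b - b'\<bar>"
    using assms by (intro add_mono mult_left_le mult_left_le_one_le) auto
  finally show ?thesis .
qed

definition unit_valued :: "('a::topological_space \<Rightarrow> real) set" where
  "unit_valued = {u \<in> borel_measurable borel. \<forall>y. 0 \<le> u y \<and> u y \<le> 1}"

lemma unit_valuedD:
  assumes "u \<in> unit_valued"
  shows "u \<in> borel_measurable borel" "0 \<le> u y" "u y \<le> 1" "\<bar>u y\<bar> \<le> 1"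
  using assms by (auto simp: unit_valued_def)

lemma indicator_unit_valued: "A \<in> sets borel \<Longrightarrow> indicator A \<in> unit_valued"
  by (auto simp: unit_valued_def indicator_def)

lemma continuous_unit_valued:
  "continuous_on UNIV f \<Longrightarrow> (\<And>y. 0 \<le> f y \<and> f y \<le> 1) \<Longrightarrow> f \<in> unit_valued"
  by (auto simp: unit_valued_def intro: borel_measurable_continuous_onI)

definition corr :: "('a \<Rightarrow> 'a) \<Rightarrow> 'a measure \<Rightarrow> ('a \<Rightarrow> real) \<Rightarrow> ('a \<Rightarrow> real) \<Rightarrow> nat \<Rightarrow> real" where
  "corr T \<mu> u v n = (\<integral>y. u y * v ((T ^^ n) y) \<partial>\<mu>) - (\<integral>y. u y \<partial>\<mu>) * (\<integral>y. v y \<partial>\<mu>)"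

context
  fixes T :: "'a::metric_space \<Rightarrow> 'a" and \<mu> :: "'a measure"
  assumes inv: "invariant_prob T \<mu>" and cT: "continuous_on UNIV T"
begin

lemma unit_valued_funpow: "v \<in> unit_valued \<Longrightarrow> (\<lambda>y. v ((T ^^ n) y)) \<in> unit_valued"
  using borel_measurable_funpow[OF cT] by (auto simp: unit_valued_def)

lemma unit_valued_mult: "u \<in> unit_valued \<Longrightarrow> v \<in> unit_valued \<Longrightarrow> (\<lambda>y. u y * v y) \<in> unit_valued"
  by (auto simp: unit_valued_def mult_le_one)

lemma integrable_unit_valued: "u \<in> unit_valued \<Longrightarrow> integrable \<mu> u"
  by (rule integrable_bounded[OF inv]) (auto dest: unit_valuedD)

lemma integrable_corr: "u \<in> unit_valued \<Longrightarrow> v \<in> unit_valued \<Longrightarrow> integrable \<mu> (\<lambda>y. u y * v ((T ^^ n) y))"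
  by (intro integrable_unit_valued unit_valued_mult unit_valued_funpow)

lemma integral_unit_valued:
  assumes "u \<in> unit_valued"
  shows "0 \<le> (\<integral>y. u y \<partial>\<mu>)" "(\<integral>y. u y \<partial>\<mu>) \<le> 1"
proof -
  interpret prob_space \<mu> using inv by (simp add: invariant_prob_def)
  show "0 \<le> (\<integral>y. u y \<partial>\<mu>)" 
    using assms by (intro Bochner_Integration.integral_nonneg) (simp add: unit_valued_def)
  have "(\<integral>y. u y \<partial>\<mu>) \<le> (\<integral>y. 1 \<partial>\<mu>)"
    using assms by (intro integral_mono integrable_unit_valued) (auto simp: unit_valued_def)
  then show "(\<integral>y. u y \<partial>\<mu>) \<le> 1" by (simp add: prob_space)
qed

text \<open>The bound does not depend on \<open>n\<close>, because by invariance \<open>v \<circ> T^n\<close> and \<open>v' \<circ> T^n\<close> are as close in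
  \<open>L1\<close> as \<open>v\<close> and \<open>v'\<close>. The factor \<open>2\<close> accounts for the two terms of a correlation.\<close>

lemma corr_diff_le:
  assumes u: "u \<in> unit_valued" and v: "v \<in> unit_valued"
    and u': "u' \<in> unit_valued" and v': "v' \<in> unit_valued"
  shows "\<bar>corr T \<mu> u v n - corr T \<mu> u' v' n\<bar> \<le> 2 * ((\<integral>y. \<bar>u y - u' y\<bar> \<partial>\<mu>) + (\<integral>y. \<bar>v y - v' y\<bar> \<partial>\<mu>))"
proof -
  note I = integrable_unit_valued
  have Iu: "integrable \<mu> (\<lambda>y. \<bar>u y - u' y\<bar>)"
    using I[OF u] I[OF u'] by (intro integrable_abs Bochner_Integration.integrable_diff)
  have bv: "(\<lambda>y. \<bar>v y - v' y\<bar>) \<in> borel_measurable borel"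
    using unit_valuedD(1)[OF v] unit_valuedD(1)[OF v'] by measurable
  have Iv: "integrable \<mu> (\<lambda>y. \<bar>v y - v' y\<bar>)"
    using I[OF v] I[OF v'] by (intro integrable_abs Bochner_Integration.integrable_diff)
  have Ivn: "integrable \<mu> (\<lambda>y. \<bar>v ((T ^^ n) y) - v' ((T ^^ n) y)\<bar>)"
    using I[OF unit_valued_funpow[OF v]] I[OF unit_valued_funpow[OF v']]
    by (intro integrable_abs Bochner_Integration.integrable_diff)
  have "(\<integral>y. u y * v ((T ^^ n) y) \<partial>\<mu>) - (\<integral>y. u' y * v' ((T ^^ n) y) \<partial>\<mu>)
      = (\<integral>y. u y * v ((T ^^ n) y) - u' y * v' ((T ^^ n) y) \<partial>\<mu>)"
    by (intro Bochner_Integration.integral_diff[symmetric] integrable_corr u v u' v')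
  also have "\<bar>\<dots>\<bar> \<le> (\<integral>y. \<bar>u y * v ((T ^^ n) y) - u' y * v' ((T ^^ n) y)\<bar> \<partial>\<mu>)"
    by (rule integral_abs_bound)
  also have "\<dots> \<le> (\<integral>y. \<bar>u y - u' y\<bar> + \<bar>v ((T ^^ n) y) - v' ((T ^^ n) y)\<bar> \<partial>\<mu>)"
    by (intro integral_mono integrable_abs Bochner_Integration.integrable_diff
        Bochner_Integration.integrable_add integrable_corr u v u' v' Iu Ivn mult_diff_le
        unit_valuedD(2,3))
  also have "\<dots> = (\<integral>y. \<bar>u y - u' y\<bar> \<partial>\<mu>) + (\<integral>y. \<bar>v y - v' y\<bar> \<partial>\<mu>)"
    using invariant_integral[OF inv cT bv, of n] by (simp add: Bochner_Integration.integral_add[OF Iu Ivn])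
  finally have 1: "\<bar>(\<integral>y. u y * v ((T ^^ n) y) \<partial>\<mu>) - (\<integral>y. u' y * v' ((T ^^ n) y) \<partial>\<mu>)\<bar>
      \<le> (\<integral>y. \<bar>u y - u' y\<bar> \<partial>\<mu>) + (\<integral>y. \<bar>v y - v' y\<bar> \<partial>\<mu>)" .
  have L1: "\<bar>(\<integral>y. w y \<partial>\<mu>) - (\<integral>y. w' y \<partial>\<mu>)\<bar> \<le> (\<integral>y. \<bar>w y - w' y\<bar> \<partial>\<mu>)"
    if "w \<in> unit_valued" "w' \<in> unit_valued" for w w'
    using that by (subst Bochner_Integration.integral_diff[symmetric])
      (auto intro: I integral_abs_bound)
  have 2: "\<bar>(\<integral>y. u y \<partial>\<mu>) * (\<integral>y. v y \<partial>\<mu>) - (\<integral>y. u' y \<partial>\<mu>) * (\<integral>y. v' y \<partial>\<mu>)\<bar>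
      \<le> (\<integral>y. \<bar>u y - u' y\<bar> \<partial>\<mu>) + (\<integral>y. \<bar>v y - v' y\<bar> \<partial>\<mu>)"
    using L1[OF u u'] L1[OF v v']
    by (intro order_trans[OF mult_diff_le add_mono] integral_unit_valued u v u' v')
  have "\<bar>(a - c) - (b - d)\<bar> \<le> 2 * s" if "\<bar>a - b\<bar> \<le> s" "\<bar>c - d\<bar> \<le> s" for a b c d s :: real
    using that by linarith
  from this[OF 1 2] show ?thesis unfolding corr_def .
qed

lemma unit_valued_mean:
  assumes "\<And>k. k < p \<Longrightarrow> a k \<in> unit_valued"
  shows "(\<lambda>y. (\<Sum>k<p. a k y) / real p) \<in> unit_valued"
proof -
  have "(\<lambda>y. (\<Sum>k<p. a k y) / real p) \<in> borel_measurable borel"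
    using assms by (intro borel_measurable_divide borel_measurable_sum) (auto dest: unit_valuedD)
  moreover have "(\<Sum>k<p. a k y) / real p \<le> 1" for y
    using sum_bounded_above[of "{..<p}" "\<lambda>k. a k y" 1] assms
    by (auto simp: divide_le_eq dest: unit_valuedD)
  moreover have "0 \<le> (\<Sum>k<p. a k y) / real p" for y
    using assms by (intro divide_nonneg_nonneg sum_nonneg) (auto dest: unit_valuedD)
  ultimately show ?thesis by (simp add: unit_valued_def)
qed

lemma corr_mean_left:
  assumes a: "\<And>k. k < p \<Longrightarrow> a k \<in> unit_valued" and v: "v \<in> unit_valued"
  shows "corr T \<mu> (\<lambda>y. (\<Sum>k<p. a k y) / real p) v n = (\<Sum>k<p. corr T \<mu> (a k) v n) / real p"
proof -
  have "(\<integral>y. (\<Sum>k<p. a k y) / real p * v ((T ^^ n) y) \<partial>\<mu>)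
      = (\<integral>y. (\<Sum>k<p. a k y * v ((T ^^ n) y)) / real p \<partial>\<mu>)"
    by (simp add: sum_distrib_right)
  also have "\<dots> = (\<Sum>k<p. \<integral>y. a k y * v ((T ^^ n) y) \<partial>\<mu>) / real p"
    using a v by (simp add: integrable_corr)
  finally show ?thesis
    using a by (simp add: corr_def integrable_unit_valued sum_subtractf diff_divide_distrib sum_distrib_right)
qed

lemma corr_mean_right:
  assumes a: "\<And>k. k < p \<Longrightarrow> a k \<in> unit_valued" and u: "u \<in> unit_valued"
  shows "corr T \<mu> u (\<lambda>y. (\<Sum>k<p. a k y) / real p) n = (\<Sum>k<p. corr T \<mu> u (a k) n) / real p"
proof -
  have "(\<integral>y. u y * ((\<Sum>k<p. a k ((T ^^ n) y)) / real p) \<partial>\<mu>)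
      = (\<integral>y. (\<Sum>k<p. u y * a k ((T ^^ n) y)) / real p \<partial>\<mu>)"
    by (simp add: sum_distrib_left)
  also have "\<dots> = (\<Sum>k<p. \<integral>y. u y * a k ((T ^^ n) y) \<partial>\<mu>) / real p"
    using a u by (simp add: integrable_corr)
  finally show ?thesis
    using a by (simp add: corr_def integrable_unit_valued sum_subtractf diff_divide_distrib sum_distrib_left)
qed

lemma means_vanish_corr_L1:
  assumes S: "averaging S" and u: "u \<in> unit_valued" and v: "v \<in> unit_valued"
    and approx: "\<And>e. 0 < e \<Longrightarrow> \<exists>u'\<in>unit_valued. \<exists>v'\<in>unit_valued.
      (\<integral>y. \<bar>u y - u' y\<bar> \<partial>\<mu>) \<le> e \<and> (\<integral>y. \<bar>v y - v' y\<bar> \<partial>\<mu>) \<le> e \<and> means_vanish S (corr T \<mu> u' v')"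
  shows "means_vanish S (corr T \<mu> u v)"
proof (rule means_vanish_uniform_limit[OF S])
  fix e :: real assume "0 < e"
  then obtain u' v' where w: "u' \<in> unit_valued" "v' \<in> unit_valued"
    "(\<integral>y. \<bar>u y - u' y\<bar> \<partial>\<mu>) \<le> e / 4" "(\<integral>y. \<bar>v y - v' y\<bar> \<partial>\<mu>) \<le> e / 4" "means_vanish S (corr T \<mu> u' v')"
    using approx[of "e / 4"] by auto
  have "\<bar>corr T \<mu> u v n - corr T \<mu> u' v' n\<bar> \<le> e" for n
  proof -
    have "2 * ((\<integral>y. \<bar>u y - u' y\<bar> \<partial>\<mu>) + (\<integral>y. \<bar>v y - v' y\<bar> \<partial>\<mu>)) \<le> 2 * (e / 4 + e / 4)"
      by (intro mult_left_mono add_mono w) simp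
    with corr_diff_le[OF u v w(1,2), of n] show ?thesis by (rule order_trans[OF _ order_trans]) simp
  qed
  then show "\<exists>b. means_vanish S b \<and> (\<forall>n. \<bar>corr T \<mu> u v n - b n\<bar> \<le> e)"
    using w(5) by blast
qed

end

text \<open>The number of integers \<open>k < n\<close> with \<open>k < t\<close> is the ceiling of \<open>t\<close>, cut off at \<open>n\<close>.\<close>

lemma count_layers:
  fixes t :: real
  assumes "0 \<le> t"
  shows "min t (real n) \<le> (\<Sum>k<n. of_bool (real k < t))
       \<and> (\<Sum>k<n. of_bool (real k < t)) \<le> min (t + 1) (real n)"
proof (induction n)
  case (Suc n)
  then show ?case by (cases "real n < t") (auto simp: min_def split: if_splits)
qed (use assms in auto)

text \<open>Both directions are \<open>L1\<close> approximation. Indicators of Borel sets are approximated by continuous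
  functions. Conversely a continuous \<open>f\<close> with values in \<open>[0, 1]\<close> lies within \<open>1 / p\<close> of the mean of the
  indicators of its \<open>p\<close> superlevel sets \<open>{f > k / p}\<close>, and correlations are linear in each argument.\<close>

lemma decorrelation_continuous_iff_sets:
  fixes T :: "'a::metric_space \<Rightarrow> 'a"
  assumes inv: "invariant_prob T \<mu>" and cT: "continuous_on UNIV T" and S: "averaging S"
  shows "(\<forall>f g. continuous_on UNIV f \<and> continuous_on UNIV g \<and> (\<forall>y. 0 \<le> f y \<and> f y \<le> 1) \<and> (\<forall>y. 0 \<le> g y \<and> g y \<le> 1)
            \<longrightarrow> means_vanish S (corr T \<mu> f g)) \<longleftrightarrow>
         (\<forall>A\<in>sets borel. \<forall>B\<in>sets borel. means_vanish S (corr T \<mu> (indicator A) (indicator B)))"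
    (is "?C \<longleftrightarrow> ?B")
proof
  have fin: "finite_measure \<mu>" and sets: "sets \<mu> = sets borel" 
    using inv by (auto simp: invariant_prob_def prob_space.finite_measure)
  {
    assume C: ?C
    show ?B
    proof (intro ballI means_vanish_corr_L1[OF inv cT S] indicator_unit_valued)
      fix A B :: "'a set" and e :: real
      assume "A \<in> sets borel" "B \<in> sets borel" "0 < e"
      then obtain f g :: "'a \<Rightarrow> real" where fg: "continuous_on UNIV f" "\<forall>y. 0 \<le> f y \<and> f y \<le> 1" "(\<integral>y. \<bar>indicator A y - f y\<bar> \<partial>\<mu>) < e"
        "continuous_on UNIV g" "\<forall>y. 0 \<le> g y \<and> g y \<le> 1" "(\<integral>y. \<bar>indicator B y - g y\<bar> \<partial>\<mu>) < e"
        using borel_indicator_L1_approx[OF fin sets] by meson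
      then show "\<exists>u'\<in>unit_valued. \<exists>v'\<in>unit_valued. (\<integral>y. \<bar>indicator A y - u' y\<bar> \<partial>\<mu>) \<le> e \<and>
          (\<integral>y. \<bar>indicator B y - v' y\<bar> \<partial>\<mu>) \<le> e \<and> means_vanish S (corr T \<mu> u' v')"
        using C by (intro bexI[of _ f] bexI[of _ g]) (auto intro: continuous_unit_valued)
    qed
  }
  {
    assume B: ?B
    interpret prob_space \<mu> using inv by (simp add: invariant_prob_def)
    \<comment> \<open>The number of levels \<open>k / p\<close> that lie below \<open>f y\<close>, as a fraction of \<open>p\<close>.\<close>
    define lay where "lay p f y = (\<Sum>k<p. indicator {y. real k < real p * f y} y) / real p"
      for p :: nat and f :: "'a \<Rightarrow> real" and y
    have layers: "{y. real k < real p * f y} \<in> sets borel" if "continuous_on UNIV f" for k p and f :: "'a \<Rightarrow> real"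
      using that by (intro borel_open open_Collect_less continuous_intros)
    have lay_unit: "lay p f \<in> unit_valued" if "continuous_on UNIV f" for p f
      unfolding lay_def by (intro unit_valued_mean[OF inv cT] indicator_unit_valued layers that)
    have lay_L1: "(\<integral>y. \<bar>f y - lay p f y\<bar> \<partial>\<mu>) \<le> 1 / real p"
      if "continuous_on UNIV f" and f: "\<forall>y. 0 \<le> f y \<and> f y \<le> 1" and p: "0 < p" for p f
    proof -
      have "\<bar>f y - lay p f y\<bar> \<le> 1 / real p" for y
      proof -
        have "0 \<le> real p * f y" "real p * f y \<le> real p" using f p by (auto simp: mult_left_le)
        moreover have "lay p f y * real p = (\<Sum>k<p. of_bool (real k < real p * f y))"
          using p by (simp add: lay_def indicator_def)
        ultimately have "\<bar>real p * f y - lay p f y * real p\<bar> \<le> 1"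
          using count_layers[of "real p * f y" p] by simp
        also have "real p * f y - lay p f y * real p = (f y - lay p f y) * real p" by (simp add: algebra_simps)
        finally have "\<bar>f y - lay p f y\<bar> * real p \<le> 1" by (simp only: abs_mult abs_of_nat)
        then show ?thesis using p by (simp add: pos_le_divide_eq)
      qed
      then have "(\<integral>y. \<bar>f y - lay p f y\<bar> \<partial>\<mu>) \<le> (\<integral>y. 1 / real p \<partial>\<mu>)"
        using lay_unit[OF that(1), of p] continuous_unit_valued[of f] that
        by (intro integral_mono integrable_abs Bochner_Integration.integrable_diff integrable_unit_valued[OF inv cT])
            (auto simp: unit_valued_def)
      then show ?thesis by (simp add: prob_space)
    qed
    show ?C
    proof (intro allI impI, elim conjE)
      fix f g :: "'a \<Rightarrow> real"
      assume f: "continuous_on UNIV f" "\<forall>y. 0 \<le> f y \<and> f y \<le> 1"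
        and g: "continuous_on UNIV g" "\<forall>y. 0 \<le> g y \<and> g y \<le> 1"
      show "means_vanish S (corr T \<mu> f g)"
      proof (rule means_vanish_corr_L1[OF inv cT S])
        show "f \<in> unit_valued" "g \<in> unit_valued" using f g by (auto intro: continuous_unit_valued)
        fix e :: real assume "0 < e"
        then obtain m where m: "inverse (real (Suc m)) < e" using reals_Archimedean by blast
        define p where "p = Suc m"
        have p: "0 < p" "1 / real p \<le> e" using m by (auto simp: p_def inverse_eq_divide)
        have "corr T \<mu> (lay p f) (lay p g) = (\<lambda>n. (\<Sum>k<p. (\<Sum>l<p.
            corr T \<mu> (indicator {y. real k < real p * f y}) (indicator {y. real l < real p * g y}) n) / real p) / real p)"
        proof
          fix n
          have "corr T \<mu> (lay p f) (lay p g) n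
              = (\<Sum>k<p. corr T \<mu> (indicator {y. real k < real p * f y}) (lay p g) n) / real p"
            unfolding lay_def[of p f, abs_def]
            by (intro corr_mean_left[OF inv cT] indicator_unit_valued layers f lay_unit g)
          also have "\<dots> = (\<Sum>k<p. (\<Sum>l<p.
            corr T \<mu> (indicator {y. real k < real p * f y}) (indicator {y. real l < real p * g y}) n) / real p) / real p"
            unfolding lay_def[of p g, abs_def]
            by (intro arg_cong2[where f = "(/)"] sum.cong refl corr_mean_right[OF inv cT] indicator_unit_valued layers f g)
          finally show "corr T \<mu> (lay p f) (lay p g) n = (\<Sum>k<p. (\<Sum>l<p.
            corr T \<mu> (indicator {y. real k < real p * f y}) (indicator {y. real l < real p * g y}) n) / real p) / real p" .
        qed
        then have "means_vanish S (corr T \<mu> (lay p f) (lay p g))"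
          using B layers f g by (auto intro!: means_vanish_mean)
        then show "\<exists>u'\<in>unit_valued. \<exists>v'\<in>unit_valued. (\<integral>y. \<bar>f y - u' y\<bar> \<partial>\<mu>) \<le> e \<and>
            (\<integral>y. \<bar>g y - v' y\<bar> \<partial>\<mu>) \<le> e \<and> means_vanish S (corr T \<mu> u' v')"
          using lay_unit f g lay_L1[OF f p(1)] lay_L1[OF g p(1)] p(2)
          by (intro bexI[of _ "lay p f"] bexI[of _ "lay p g"] conjI) auto
      qed
    qed
  }
qed

lemma corr_indicator:
  fixes T :: "'a::metric_space \<Rightarrow> 'a"
  assumes inv: "invariant_prob T \<mu>" and cT: "continuous_on UNIV T"
    and A: "A \<in> sets borel" and B: "B \<in> sets borel"
  shows "corr T \<mu> (indicator A) (indicator B) n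
       = measure \<mu> (A \<inter> (T ^^ n) -` B) - measure \<mu> A * measure \<mu> B"
proof -
  have sets: "sets \<mu> = sets borel" using inv by (simp add: invariant_prob_def)
  have "(T ^^ n) -` B \<in> sets borel"
    using measurable_sets[OF borel_measurable_continuous_onI[OF continuous_on_funpow[OF cT]] B, of n] by simp
  then have "A \<inter> (T ^^ n) -` B \<in> sets \<mu>" using A sets by simp
  moreover have "indicator A y * indicator B ((T ^^ n) y) = (indicator (A \<inter> (T ^^ n) -` B) y :: real)" for y
    by (simp add: indicator_def)
  ultimately show ?thesis using A B sets by (simp add: corr_def)
qed

section \<open>Mixing and ergodicity as decay of averaged correlations\<close>

lemma mixing_iff_means_vanish:
  fixes T :: "'a::metric_space \<Rightarrow> 'a"
  assumes inv: "invariant_prob T \<mu>" and cT: "continuous_on UNIV T"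
  shows "mixing T \<mu> \<longleftrightarrow>
    (\<forall>A\<in>sets borel. \<forall>B\<in>sets borel. means_vanish (\<lambda>N. {N}) (corr T \<mu> (indicator A) (indicator B)))"
  unfolding mixing_def means_vanish_def
  by (intro ball_cong refl) (simp add: corr_indicator[OF inv cT] LIM_zero_iff)

text \<open>If \<open>\<mu>\<close> is ergodic, the averages of \<open>indicator B\<close> along orbits converge to the measure of \<open>B\<close> almost
  everywhere; multiply by \<open>indicator A\<close> and integrate. In the other direction an invariant set \<open>A\<close> has
  the same correlation \<open>\<mu> A - (\<mu> A)^2\<close> with itself at every time, so this number is \<open>0\<close>.
  The index sets are \<open>{..<Suc N}\<close> so that none of them is empty.\<close>

lemma ergodic_iff_means_vanish:
  fixes T :: "'a::metric_space \<Rightarrow> 'a"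
  assumes inv: "invariant_prob T \<mu>" and cT: "continuous_on UNIV T"
  shows "ergodic T \<mu> \<longleftrightarrow>
    (\<forall>A\<in>sets borel. \<forall>B\<in>sets borel. means_vanish (\<lambda>N. {..<Suc N}) (corr T \<mu> (indicator A) (indicator B)))"
proof
  interpret prob_space \<mu> using inv by (simp add: invariant_prob_def)
  assume erg: "ergodic T \<mu>"
  show "\<forall>A\<in>sets borel. \<forall>B\<in>sets borel. means_vanish (\<lambda>N. {..<Suc N}) (corr T \<mu> (indicator A) (indicator B))"
  proof (intro ballI)
    fix A B :: "'a set" assume AB: "A \<in> sets borel" "B \<in> sets borel"
    define u v where "u = (indicator A :: 'a \<Rightarrow> real)" and "v = (indicator B :: 'a \<Rightarrow> real)"
    have uv: "u \<in> unit_valued" "v \<in> unit_valued"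
      unfolding u_def v_def using AB by (auto intro: indicator_unit_valued)
    define w where "w n y = (\<Sum>j<n. v ((T ^^ j) y)) / real n" for n y
    have w: "w n \<in> unit_valued" for n
      unfolding w_def by (intro unit_valued_mean[OF inv cT] unit_valued_funpow[OF inv cT] uv)
    note I = integrable_unit_valued[OF inv cT]
    have "(\<lambda>n. \<integral>y. u y * w n y \<partial>\<mu>) \<longlonglongrightarrow> (\<integral>y. u y * (\<integral>y. v y \<partial>\<mu>) \<partial>\<mu>)"
    proof (rule integral_dominated_convergence[where w = "\<lambda>_. 1"])
      have "AE y in \<mu>. (\<lambda>n. w n y) \<longlonglongrightarrow> (\<integral>y. v y \<partial>\<mu>)"
        unfolding w_def by (rule ergodic_birkhoff[OF inv erg cT]) (use unit_valuedD[OF uv(2)] in auto)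
      then show "AE y in \<mu>. (\<lambda>n. u y * w n y) \<longlonglongrightarrow> u y * (\<integral>y. v y \<partial>\<mu>)"
        by eventually_elim (intro tendsto_intros)
      show "AE y in \<mu>. norm (u y * w n y) \<le> 1" for n
        using unit_valuedD[OF unit_valued_mult[OF inv cT uv(1) w[of n]]] by auto
      show "(\<lambda>y. u y * w n y) \<in> borel_measurable \<mu>" for n
        using I[OF unit_valued_mult[OF inv cT uv(1) w]] by auto
      show "(\<lambda>y. u y * (\<integral>y. v y \<partial>\<mu>)) \<in> borel_measurable \<mu>"
        using I[OF uv(1)] by auto
    qed auto
    then have "(\<lambda>n. (\<integral>y. u y * w n y \<partial>\<mu>) - (\<integral>y. u y \<partial>\<mu>) * (\<integral>y. v y \<partial>\<mu>)) \<longlonglongrightarrow> 0"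
      by (simp add: LIM_zero_iff)
    then have lim: "(\<lambda>N. (\<integral>y. u y * w (Suc N) y \<partial>\<mu>) - (\<integral>y. u y \<partial>\<mu>) * (\<integral>y. v y \<partial>\<mu>)) \<longlonglongrightarrow> 0"
      by (rule LIMSEQ_Suc)
    have "(\<Sum>n<Suc N. corr T \<mu> u v n) / real (Suc N) = (\<integral>y. u y * w (Suc N) y \<partial>\<mu>) - (\<integral>y. u y \<partial>\<mu>) * (\<integral>y. v y \<partial>\<mu>)" for N
    proof -
      have "(\<integral>y. u y * w (Suc N) y \<partial>\<mu>) = (\<integral>y. (\<Sum>j<Suc N. u y * v ((T ^^ j) y)) / real (Suc N) \<partial>\<mu>)"
        by (simp add: w_def sum_distrib_left del: sum.lessThan_Suc)
      also have "\<dots> = (\<Sum>j<Suc N. \<integral>y. u y * v ((T ^^ j) y) \<partial>\<mu>) / real (Suc N)"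
        using integrable_corr[OF inv cT uv] by (simp del: sum.lessThan_Suc of_nat_Suc)
      also have "\<dots> = (\<Sum>j<Suc N. corr T \<mu> u v j + (\<integral>y. u y \<partial>\<mu>) * (\<integral>y. v y \<partial>\<mu>)) / real (Suc N)"
        by (simp add: corr_def)
      also have "\<dots> = (\<Sum>n<Suc N. corr T \<mu> u v n) / real (Suc N) + (\<integral>y. u y \<partial>\<mu>) * (\<integral>y. v y \<partial>\<mu>)"
        by (simp add: sum.distrib add_divide_distrib del: sum.lessThan_Suc of_nat_Suc)
      finally show ?thesis by simp
    qed
    then show "means_vanish (\<lambda>N. {..<Suc N}) (corr T \<mu> (indicator A) (indicator B))"
      using lim by (simp add: means_vanish_def u_def v_def del: sum.lessThan_Suc of_nat_Suc)
  qed
next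
  assume V: "\<forall>A\<in>sets borel. \<forall>B\<in>sets borel. means_vanish (\<lambda>N. {..<Suc N}) (corr T \<mu> (indicator A) (indicator B))"
  show "ergodic T \<mu>"
    unfolding ergodic_def
  proof (intro ballI impI)
    fix A :: "'a set" assume A: "A \<in> sets borel" "T -` A = A"
    have "(T ^^ n) -` A = A" for n
    proof (induction n)
      case (Suc n)
      have "(T ^^ Suc n) -` A = (T ^^ n) -` (T -` A)" by (auto simp: funpow_swap1)
      also have "\<dots> = A" by (simp only: A(2) Suc)
      finally show ?case .
    qed simp
    then have const: "corr T \<mu> (indicator A) (indicator A) = (\<lambda>n. measure \<mu> A - measure \<mu> A * measure \<mu> A)"
      by (simp add: corr_indicator[OF inv cT A(1) A(1)] fun_eq_iff)
    have "means_vanish (\<lambda>N. {..<Suc N}) (\<lambda>n. measure \<mu> A - measure \<mu> A * measure \<mu> A)"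
      using V A(1) unfolding const[symmetric] by blast
    then have "(\<lambda>N::nat. measure \<mu> A - measure \<mu> A * measure \<mu> A) \<longlonglongrightarrow> 0"
      by (simp add: means_vanish_def del: sum.lessThan_Suc of_nat_Suc)
    then have "measure \<mu> A - measure \<mu> A * measure \<mu> A = 0"
      by (simp add: LIMSEQ_const_iff)
    then show "measure \<mu> A = 0 \<or> measure \<mu> A = 1" by (simp add: algebra_simps)
  qed
qed

section \<open>Generic points\<close>

lemma generic_point_real:
  fixes f :: "'a::metric_space \<Rightarrow> real"
  assumes "generic_point T \<mu> x" "continuous_on UNIV f"
  shows "(\<lambda>n. (\<Sum>j<n. f ((T ^^ j) x)) / real n) \<longlonglongrightarrow> (\<integral>y. f y \<partial>\<mu>)"
proof -
  have "continuous_on UNIV (\<lambda>y. complex_of_real (f y))"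
    using assms(2) by (intro continuous_on_of_real)
  then have "(\<lambda>n. (\<Sum>j<n. complex_of_real (f ((T ^^ j) x))) / of_nat n) \<longlonglongrightarrow> (\<integral>y. complex_of_real (f y) \<partial>\<mu>)"
    using assms(1) unfolding generic_point_def by blast
  then have "(\<lambda>n. complex_of_real ((\<Sum>j<n. f ((T ^^ j) x)) / real n)) \<longlonglongrightarrow> complex_of_real (\<integral>y. f y \<partial>\<mu>)"
    by simp
  then show ?thesis by (simp only: tendsto_of_real_iff)
qed

lemma generic_pointI_real:
  fixes T :: "'a::metric_space \<Rightarrow> 'a"
  assumes K: "compact (UNIV :: 'a set)" and M: "finite_measure \<mu>" "sets \<mu> = sets borel"
    and lim: "\<And>f :: 'a \<Rightarrow> real. continuous_on UNIV f \<Longrightarrow>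
      (\<lambda>n. (\<Sum>j<n. f ((T ^^ j) x)) / real n) \<longlonglongrightarrow> (\<integral>y. f y \<partial>\<mu>)"
  shows "generic_point T \<mu> x"
  unfolding generic_point_def
proof (intro allI impI)
  fix f :: "'a \<Rightarrow> complex" assume f: "continuous_on UNIV f"
  have int: "integrable \<mu> f" by (rule integrable_continuous[OF K M f])
  have avg: "Re ((\<Sum>j<n. f ((T ^^ j) x)) / of_nat n) = (\<Sum>j<n. Re (f ((T ^^ j) x))) / real n"
     "Im ((\<Sum>j<n. f ((T ^^ j) x)) / of_nat n) = (\<Sum>j<n. Im (f ((T ^^ j) x))) / real n" for n
    by (simp_all add: Re_divide_of_nat Im_divide_of_nat)
  show "(\<lambda>n. (\<Sum>j<n. f ((T ^^ j) x)) / of_nat n) \<longlonglongrightarrow> integral\<^sup>L \<mu> f"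
    unfolding tendsto_complex_iff avg integral_Re[OF int, symmetric] integral_Im[OF int, symmetric]
    using f by (intro conjI lim continuous_intros)
qed

text \<open>The limits of the averages form a positive normalised functional, which is represented by a
  measure. The functional does not change when \<open>f\<close> is replaced by \<open>f \<circ> T\<close>, since that shifts the
  orbit by one step; so the measure and its image under \<open>T\<close> integrate continuous functions alike.\<close>

theorem exists_generic_measure:
  fixes T :: "'a::metric_space \<Rightarrow> 'a"
  assumes K: "compact (UNIV :: 'a set)" and cT: "continuous_on UNIV T"
    and conv: "\<And>f :: 'a \<Rightarrow> real. continuous_on UNIV f \<Longrightarrow>
      convergent (\<lambda>n. (\<Sum>j<n. f ((T ^^ j) x)) / real n)"
  shows "\<exists>\<nu>. invariant_prob T \<nu> \<and> generic_point T \<nu> x"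
proof -
  define A where "A f n = (\<Sum>j<n. f ((T ^^ j) x)) / real n" for f :: "'a \<Rightarrow> real" and n
  define L where "L f = lim (A f)" for f
  have AL: "A f \<longlonglongrightarrow> L f" if "continuous_on UNIV f" for f
    using conv[OF that] unfolding L_def A_def[abs_def] by (simp add: convergent_LIMSEQ_iff)
  have L_eqI: "L f = l" if "A f \<longlonglongrightarrow> l" for f l
    unfolding L_def using that by (rule limI)
  interpret mean_functional L
  proof
    fix f g :: "'a \<Rightarrow> real" and c :: real
    assume f: "continuous_on UNIV f"
    have "(\<lambda>n. c * A f n) \<longlonglongrightarrow> c * L f" by (intro tendsto_intros AL f)
    then show "L (\<lambda>y. c * f y) = c * L f"
      by (intro L_eqI) (simp add: A_def[abs_def] sum_distrib_left[symmetric])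
    assume g: "continuous_on UNIV g"
    have "(\<lambda>n. A f n + A g n) \<longlonglongrightarrow> L f + L g" by (intro tendsto_intros AL f g)
    then show "L (\<lambda>y. f y + g y) = L f + L g"
      by (intro L_eqI) (simp add: A_def[abs_def] sum.distrib add_divide_distrib)
    assume "\<And>y. f y \<le> g y"
    then have "A f n \<le> A g n" for n unfolding A_def by (intro divide_right_mono sum_mono) auto
    then show "L f \<le> L g" using AL[OF f] AL[OF g] by (intro LIMSEQ_le) auto
  next
    have "eventually (\<lambda>n. A (\<lambda>_. 1) n = 1) sequentially"
      by (intro eventually_sequentiallyI[of 1]) (simp add: A_def)
    then show "L (\<lambda>_. 1) = 1" by (intro L_eqI tendsto_eventually)
  qed (rule K)
  have L_T: "L (\<lambda>y. f (T y)) = L f" if f: "continuous_on UNIV f" for f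
  proof -
    have "bounded (range f)"
      using K f by (intro compact_imp_bounded compact_continuous_image)
    then obtain B where B: "\<And>y. \<bar>f y\<bar> \<le> B" by (auto simp: bounded_iff)
    have diff: "A (\<lambda>y. f (T y)) n - A f n = (f ((T ^^ n) x) - f x) / real n" for n
      using orbit_sum_Suc[of f T x n]
      by (simp add: A_def funpow_swap1 diff_divide_distrib[symmetric])
    have "(\<lambda>n. A (\<lambda>y. f (T y)) n - A f n) \<longlonglongrightarrow> 0"
    proof (rule Lim_null_comparison[where g = "\<lambda>n. 2 * B / real n"])
      show "\<forall>\<^sub>F n in sequentially. norm (A (\<lambda>y. f (T y)) n - A f n) \<le> 2 * B / real n"
      proof (rule always_eventually, rule allI)
        fix n
        have "\<bar>f ((T ^^ n) x) - f x\<bar> \<le> 2 * B" using B[of x] B[of "(T ^^ n) x"] by linarith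
        then show "norm (A (\<lambda>y. f (T y)) n - A f n) \<le> 2 * B / real n"
          unfolding diff by (simp add: divide_right_mono)
      qed
      show "(\<lambda>n. 2 * B / real n) \<longlonglongrightarrow> 0" by (rule lim_const_over_n)
    qed
    from tendsto_add[OF this AL[OF f]] show ?thesis by (intro L_eqI) simp
  qed
  have prob: "prob_space rep" by (rule prob_space_rep)
  then have fin: "finite_measure rep" by (rule prob_space.finite_measure)
  have T: "T \<in> measurable rep borel"
    using borel_measurable_continuous_onI[OF cT] measurable_cong_sets[OF sets_rep refl] by blast
  have distr: "distr rep borel T = rep"
  proof (rule borel_measure_eqI_continuous)
    show "finite_measure (distr rep borel T)"
      using prob_space.prob_space_distr[OF prob T] by (rule prob_space.finite_measure)
    fix f :: "'a \<Rightarrow> real" assume f: "continuous_on UNIV f"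
    have fT: "continuous_on UNIV (\<lambda>y. f (T y))"
      using continuous_on_compose2[OF f cT] by simp
    have "(\<integral>y. f y \<partial>distr rep borel T) = (\<integral>y. f (T y) \<partial>rep)"
      by (intro integral_distr T borel_measurable_continuous_onI f)
    then show "(\<integral>y. f y \<partial>distr rep borel T) = (\<integral>y. f y \<partial>rep)"
      by (simp add: riesz_representation f fT L_T)
  qed (simp_all add: fin sets_rep)
  have "measure rep (T -` B) = measure rep B" if "B \<in> sets borel" for B
    using measure_distr[OF T that] by (simp add: distr space_rep)
  then have "invariant_prob T rep" using prob sets_rep by (simp add: invariant_prob_def)
  moreover have "generic_point T rep x"
    using AL by (intro generic_pointI_real[OF K fin sets_rep]) (simp add: riesz_representation A_def[abs_def])
  ultimately show ?thesis by blast
qed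

section \<open>Orbits that are close in the Besicovitch pseudometric\<close>

definition orbits_close :: "('a \<Rightarrow> 'a) \<Rightarrow> 'a \<Rightarrow> 'a \<Rightarrow> ('a \<Rightarrow> real) \<Rightarrow> real \<Rightarrow> bool" where
  "orbits_close T x z f e \<longleftrightarrow>
    (\<forall>\<^sub>F n in sequentially. (\<Sum>j<n. \<bar>f ((T ^^ j) x) - f ((T ^^ j) z)\<bar>) / real n \<le> e)"

text \<open>Uniform continuity and boundedness give \<open>\<bar>f u - f v\<bar> \<le> e / 2 + C * dist u v\<close> for some \<open>C\<close>;
  averaging along the orbits turns this into the claim, with \<open>d = e / (2 * C)\<close>.\<close>

lemma besicovitch_imp_orbits_close:
  fixes f :: "'a::metric_space \<Rightarrow> real"
  assumes K: "compact (UNIV :: 'a set)" and f: "continuous_on UNIV f" and e: "0 < e"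
  shows "\<exists>d>0. \<forall>x z. besicovitch T x z < ereal d \<longrightarrow> orbits_close T x z f e"
proof -
  have "bounded (range f)"
    using K f by (intro compact_imp_bounded compact_continuous_image)
  then obtain B where B: "0 < B" "\<And>y. \<bar>f y\<bar> \<le> B" by (auto simp: bounded_pos)
  have "uniformly_continuous_on UNIV f" using f K by (rule compact_uniformly_continuous)
  then obtain \<delta> where \<delta>: "0 < \<delta>" "\<And>u v. dist u v < \<delta> \<Longrightarrow> \<bar>f u - f v\<bar> < e / 2"
    using e unfolding uniformly_continuous_on_def dist_real_def
    by (metis UNIV_I dist_commute half_gt_zero)
  \<comment> \<open>At distance at least \<open>\<delta>\<close>, the trivial bound \<open>2 * B\<close> on the difference is at most \<open>C\<close> times the distance.\<close>
  define C where "C = 2 * B / \<delta>"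
  have C: "0 < C" using B \<delta> by (simp add: C_def)
  have lip: "\<bar>f u - f v\<bar> \<le> e / 2 + C * dist u v" for u v
  proof (cases "dist u v < \<delta>")
    case True
    then show ?thesis using \<delta>(2)[OF True] C by (smt (verit) mult_nonneg_nonneg zero_le_dist)
  next
    case False
    have "2 * B = C * \<delta>" using \<delta> by (simp add: C_def)
    also have "\<dots> \<le> C * dist u v" using False C by (intro mult_left_mono) auto
    finally show ?thesis using B(2)[of u] B(2)[of v] e by linarith
  qed
  define d where "d = e / (2 * C)"
  have "orbits_close T x z f e" if "besicovitch T x z < ereal d" for x z
  proof -
    have "\<forall>\<^sub>F n in sequentially. ereal ((\<Sum>j<n. dist ((T ^^ j) x) ((T ^^ j) z)) / real n) < ereal d"
      using that unfolding besicovitch_def by (rule Limsup_lessD)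
    then show ?thesis
      unfolding orbits_close_def using eventually_gt_at_top[of 0]
    proof eventually_elim
      case (elim n)
      have "(\<Sum>j<n. \<bar>f ((T ^^ j) x) - f ((T ^^ j) z)\<bar>)
          \<le> (\<Sum>j<n. e / 2 + C * dist ((T ^^ j) x) ((T ^^ j) z))"
        by (intro sum_mono lip)
      also have "\<dots> = real n * (e / 2) + C * (\<Sum>j<n. dist ((T ^^ j) x) ((T ^^ j) z))"
        by (simp add: sum.distrib sum_distrib_left)
      also have "\<dots> \<le> real n * (e / 2) + C * (d * real n)"
        using elim C by (intro add_left_mono mult_left_mono) (auto simp: divide_less_eq)
      also have "\<dots> = e * real n" using C by (simp add: d_def field_simps)
      finally show ?case using elim by (simp add: divide_le_eq)
    qed
  qed
  moreover have "0 < d" using e C by (simp add: d_def)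
  ultimately show ?thesis by blast
qed

lemma orbits_close_averages:
  assumes "orbits_close T x z f e"
  shows "\<forall>\<^sub>F n in sequentially. \<bar>(\<Sum>j<n. f ((T ^^ j) x)) / real n - (\<Sum>j<n. f ((T ^^ j) z)) / real n\<bar> \<le> e"
  using assms unfolding orbits_close_def
proof eventually_elim
  case (elim n)
  have "\<bar>\<Sum>j<n. f ((T ^^ j) x) - f ((T ^^ j) z)\<bar> \<le> (\<Sum>j<n. \<bar>f ((T ^^ j) x) - f ((T ^^ j) z)\<bar>)"
    by (rule sum_abs)
  then have "\<bar>(\<Sum>j<n. f ((T ^^ j) x) - f ((T ^^ j) z)) / real n\<bar> \<le> (\<Sum>j<n. \<bar>f ((T ^^ j) x) - f ((T ^^ j) z)\<bar>) / real n"
    by (simp add: abs_divide divide_right_mono)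
  then show ?case
    using elim unfolding sum_subtractf diff_divide_distrib by (rule order_trans)
qed

lemma generic_integral_diff_le:
  fixes f :: "'a::metric_space \<Rightarrow> real"
  assumes "generic_point T \<nu> x" "generic_point T \<mu> z" "continuous_on UNIV f" "orbits_close T x z f e"
  shows "\<bar>(\<integral>y. f y \<partial>\<nu>) - (\<integral>y. f y \<partial>\<mu>)\<bar> \<le> e"
proof (rule tendsto_upperbound)
  show "(\<lambda>n. \<bar>(\<Sum>j<n. f ((T ^^ j) x)) / real n - (\<Sum>j<n. f ((T ^^ j) z)) / real n\<bar>)
      \<longlonglongrightarrow> \<bar>(\<integral>y. f y \<partial>\<nu>) - (\<integral>y. f y \<partial>\<mu>)\<bar>"
    using assms by (intro tendsto_intros generic_point_real)
  show "\<forall>\<^sub>F n in sequentially. \<bar>(\<Sum>j<n. f ((T ^^ j) x)) / real n - (\<Sum>j<n. f ((T ^^ j) z)) / real n\<bar> \<le> e"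
    by (rule orbits_close_averages) fact
qed simp

text \<open>The bound is uniform in the time lag \<open>m\<close>. Shifting the orbits by \<open>m\<close> changes the sum of the
  differences of \<open>g\<close> by at most \<open>m\<close>, which is negligible after division by large \<open>n\<close>; the third
  \<open>e\<close> absorbs it.\<close>

lemma orbits_close_product:
  fixes f g :: "'a::metric_space \<Rightarrow> real"
  assumes f: "\<And>y. 0 \<le> f y \<and> f y \<le> 1" and g: "\<And>y. 0 \<le> g y \<and> g y \<le> 1"
    and cf: "orbits_close T x z f e" and cg: "orbits_close T x z g e" and e: "0 < e"
  shows "orbits_close T x z (\<lambda>y. f y * g ((T ^^ m) y)) (3 * e)"
proof -
  obtain N where N: "real m < real N * e" using reals_Archimedean3[OF e] by blast
  have "\<forall>\<^sub>F n in sequentially. max 1 N \<le> n" by (rule eventually_ge_at_top)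
  with cf cg show ?thesis unfolding orbits_close_def
  proof eventually_elim
    case (elim n)
    define a where "a j = \<bar>f ((T ^^ j) x) - f ((T ^^ j) z)\<bar>" for j
    define b where "b j = \<bar>g ((T ^^ j) x) - g ((T ^^ j) z)\<bar>" for j
    have n: "0 < n" "real m \<le> e * real n"
    proof -
      have "real N * e \<le> e * real n" using elim(3) e by simp
      then show "real m \<le> e * real n" using N by linarith
    qed (use elim(3) in simp)
    have a: "(\<Sum>j<n. a j) \<le> e * real n" and b: "(\<Sum>j<n. b j) \<le> e * real n"
      using elim(1,2) n by (simp_all add: a_def b_def divide_le_eq)
    have b1: "b j \<le> 1" for j
      using g[of "(T ^^ j) x"] g[of "(T ^^ j) z"] by (simp add: b_def abs_le_iff)
    have "(\<Sum>j<n. b (j + m)) = (\<Sum>j\<in>{m..<n+m}. b j)"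
      using sum.shift_bounds_nat_ivl[of b 0 m n] by (simp add: atLeast0LessThan)
    also have "\<dots> \<le> (\<Sum>j\<in>{..<n} \<union> {n..<n+m}. b j)"
      by (intro sum_mono2) (auto simp: b_def)
    also have "\<dots> = (\<Sum>j<n. b j) + (\<Sum>j\<in>{n..<n+m}. b j)"
      by (intro sum.union_disjoint) auto
    also have "\<dots> \<le> e * real n + real m"
      using b sum_bounded_above[of "{n..<n+m}" b 1] b1 by simp
    finally have shift: "(\<Sum>j<n. b (j + m)) \<le> e * real n + real m" .
    have "(\<Sum>j<n. \<bar>f ((T ^^ j) x) * g ((T ^^ m) ((T ^^ j) x)) - f ((T ^^ j) z) * g ((T ^^ m) ((T ^^ j) z))\<bar>)
        \<le> (\<Sum>j<n. a j + b (j + m))"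
    proof (intro sum_mono)
      fix j
      have pw: "(T ^^ m) ((T ^^ j) w) = (T ^^ (j + m)) w" for w
        by (simp add: funpow_add add.commute[of j m])
      show "\<bar>f ((T ^^ j) x) * g ((T ^^ m) ((T ^^ j) x)) - f ((T ^^ j) z) * g ((T ^^ m) ((T ^^ j) z))\<bar> \<le> a j + b (j + m)"
        unfolding pw a_def b_def using f g by (intro mult_diff_le) auto
    qed
    also have "\<dots> \<le> 3 * e * real n" using a shift n by (simp add: sum.distrib)
    finally show ?case using n by (simp add: divide_le_eq)
  qed
qed

text \<open>For continuous functions, correlations are expressed through limits of averages along the orbits of
  generic points, so closeness of the orbits bounds their difference uniformly in the time \<open>n\<close>.\<close>

lemma generic_corr_diff_le:
  fixes f g :: "'a::metric_space \<Rightarrow> real"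
  assumes cT: "continuous_on UNIV T"
    and inv\<nu>: "invariant_prob T \<nu>" and inv\<mu>: "invariant_prob T \<mu>"
    and \<nu>: "generic_point T \<nu> x" and \<mu>: "generic_point T \<mu> z"
    and f: "continuous_on UNIV f" "\<And>y. 0 \<le> f y \<and> f y \<le> 1"
    and g: "continuous_on UNIV g" "\<And>y. 0 \<le> g y \<and> g y \<le> 1"
    and cf: "orbits_close T x z f e" and cg: "orbits_close T x z g e" and e: "0 < e"
  shows "\<bar>corr T \<nu> f g n - corr T \<mu> f g n\<bar> \<le> 5 * e"
proof -
  have "continuous_on UNIV (\<lambda>y. f y * g ((T ^^ n) y))"
    using continuous_on_compose2[OF g(1) continuous_on_funpow[OF cT]] f(1) by (intro continuous_on_mult) auto
  then have 1: "\<bar>(\<integral>y. f y * g ((T ^^ n) y) \<partial>\<nu>) - (\<integral>y. f y * g ((T ^^ n) y) \<partial>\<mu>)\<bar> \<le> 3 * e"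
    by (intro generic_integral_diff_le[OF \<nu> \<mu>] orbits_close_product f g cf cg e)
  have fu: "f \<in> unit_valued" and gu: "g \<in> unit_valued" using f g by (auto intro: continuous_unit_valued)
  have "\<bar>(\<integral>y. f y \<partial>\<nu>) * (\<integral>y. g y \<partial>\<nu>) - (\<integral>y. f y \<partial>\<mu>) * (\<integral>y. g y \<partial>\<mu>)\<bar>
      \<le> \<bar>(\<integral>y. f y \<partial>\<nu>) - (\<integral>y. f y \<partial>\<mu>)\<bar> + \<bar>(\<integral>y. g y \<partial>\<nu>) - (\<integral>y. g y \<partial>\<mu>)\<bar>"
    using integral_unit_valued[OF inv\<mu> cT fu] integral_unit_valued[OF inv\<nu> cT gu] by (intro mult_diff_le)
  also have "\<dots> \<le> e + e"
    by (intro add_mono generic_integral_diff_le[OF \<nu> \<mu>] f g cf cg)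
  finally have 2: "\<bar>(\<integral>y. f y \<partial>\<nu>) * (\<integral>y. g y \<partial>\<nu>) - (\<integral>y. f y \<partial>\<mu>) * (\<integral>y. g y \<partial>\<mu>)\<bar> \<le> 2 * e" by simp
  have "\<bar>(a - c) - (b - d)\<bar> \<le> 5 * e" if "\<bar>a - b\<bar> \<le> 3 * e" "\<bar>c - d\<bar> \<le> 2 * e" for a b c d :: real
    using that by linarith
  from this[OF 1 2] show ?thesis unfolding corr_def .
qed

theorem lemma8p2:
  fixes T :: "'a::metric_space \<Rightarrow> 'a"
    and xs :: "nat \<Rightarrow> 'a" and x :: 'a
    and \<mu> :: "nat \<Rightarrow> 'a measure"
  assumes "compact (UNIV :: 'a set)"
    and "homeomorphic_map euclidean euclidean T"
    and "\<And>m. m \<ge> 1 \<Longrightarrow> invariant_prob T (\<mu> m)"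
    and "\<And>m. m \<ge> 1 \<Longrightarrow> generic_point T (\<mu> m) (xs m)"
    and "(\<lambda>m. besicovitch T x (xs m)) \<longlonglongrightarrow> 0"
  shows "((\<forall>m\<ge>1. mixing T (\<mu> m)) \<longrightarrow>
            (\<exists>\<nu>. invariant_prob T \<nu> \<and> mixing T \<nu> \<and> generic_point T \<nu> x)) \<and>
         ((\<forall>m\<ge>1. ergodic T (\<mu> m)) \<longrightarrow>
            (\<exists>\<nu>. invariant_prob T \<nu> \<and> ergodic T \<nu> \<and> generic_point T \<nu> x))"
proof -
  note K = assms(1) and inv = assms(3) and gen = assms(4)
  have cT: "continuous_on UNIV T"
    using homeomorphic_imp_continuous_map[OF assms(2)] by simp
  have close: "\<forall>\<^sub>F m in sequentially. 1 \<le> m \<and> orbits_close T x (xs m) f e"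
    if f: "continuous_on UNIV f" and e: "0 < e" for f e
  proof -
    obtain d where d: "0 < d" "\<And>z. besicovitch T x z < ereal d \<Longrightarrow> orbits_close T x z f e"
      using besicovitch_imp_orbits_close[OF K f e] by blast
    have "\<forall>\<^sub>F m in sequentially. besicovitch T x (xs m) < ereal d"
      using assms(5) d(1) by (intro order_tendstoD) auto
    then show ?thesis
      using eventually_ge_at_top[of 1] by eventually_elim (auto intro: d(2))
  qed
  have "convergent (\<lambda>n. (\<Sum>j<n. f ((T ^^ j) x)) / real n)" if f: "continuous_on UNIV f" for f :: "'a \<Rightarrow> real"
  proof (rule Cauchy_convergent, rule metric_CauchyI)
    fix e :: real assume e: "0 < e"
    then obtain m where m: "1 \<le> m" "orbits_close T x (xs m) f (e / 4)"
      using eventually_happens[OF close[OF f, of "e / 4"]] by auto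
    define A where "A z n = (\<Sum>j<n. f ((T ^^ j) z)) / real n" for z n
    have "\<forall>\<^sub>F n in sequentially. dist (A (xs m) n) (\<integral>y. f y \<partial>\<mu> m) < e / 4"
      unfolding A_def using e by (intro tendstoD[OF generic_point_real[OF gen[OF m(1)] f]]) simp
    then have "\<forall>\<^sub>F n in sequentially. dist (A x n) (\<integral>y. f y \<partial>\<mu> m) < e / 2"
      using orbits_close_averages[OF m(2)]
      unfolding dist_real_def A_def[symmetric] by eventually_elim linarith
    then obtain N where N: "\<And>n. N \<le> n \<Longrightarrow> dist (A x n) (\<integral>y. f y \<partial>\<mu> m) < e / 2"
      by (auto simp: eventually_sequentially)
    then show "\<exists>M. \<forall>k\<ge>M. \<forall>n\<ge>M. dist ((\<Sum>j<k. f ((T ^^ j) x)) / real k) ((\<Sum>j<n. f ((T ^^ j) x)) / real n) < e"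
      unfolding A_def by (blast intro: dist_triangle_half_l)
  qed
  from exists_generic_measure[OF K cT this]
  obtain \<nu> where \<nu>: "invariant_prob T \<nu>" "generic_point T \<nu> x" by blast
  have transfer: "\<forall>A\<in>sets borel. \<forall>B\<in>sets borel. means_vanish S (corr T \<nu> (indicator A) (indicator B))"
    if S: "averaging S"
      and V: "\<And>m. 1 \<le> m \<Longrightarrow> \<forall>A\<in>sets borel. \<forall>B\<in>sets borel. means_vanish S (corr T (\<mu> m) (indicator A) (indicator B))" for S
    unfolding decorrelation_continuous_iff_sets[OF \<nu>(1) cT S, symmetric]
  proof (intro allI impI, elim conjE)
    fix f g :: "'a \<Rightarrow> real"
    assume f: "continuous_on UNIV f" "\<forall>y. 0 \<le> f y \<and> f y \<le> 1"
      and g: "continuous_on UNIV g" "\<forall>y. 0 \<le> g y \<and> g y \<le> 1"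
    show "means_vanish S (corr T \<nu> f g)"
    proof (rule means_vanish_uniform_limit[OF S])
      fix e :: real assume e: "0 < e"
      have "\<forall>\<^sub>F m in sequentially. 1 \<le> m \<and> orbits_close T x (xs m) f (e / 5) \<and> orbits_close T x (xs m) g (e / 5)"
        using close[OF f(1), of "e / 5"] close[OF g(1), of "e / 5"] e by (auto elim: eventually_elim2)
      then obtain m where m: "1 \<le> m" "orbits_close T x (xs m) f (e / 5)" "orbits_close T x (xs m) g (e / 5)"
        using eventually_happens by force
      have "\<bar>corr T \<nu> f g n - corr T (\<mu> m) f g n\<bar> \<le> 5 * (e / 5)" for n
        using f g m e by (intro generic_corr_diff_le[OF cT \<nu>(1) inv \<nu>(2) gen]) auto
      moreover have "means_vanish S (corr T (\<mu> m) f g)"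
        using V[OF m(1)] f g unfolding decorrelation_continuous_iff_sets[OF inv[OF m(1)] cT S, symmetric] by blast
      ultimately show "\<exists>b. means_vanish S b \<and> (\<forall>n. \<bar>corr T \<nu> f g n - b n\<bar> \<le> e)" by auto
    qed
  qed
  have "mixing T \<nu>" if "\<forall>m\<ge>1. mixing T (\<mu> m)"
    unfolding mixing_iff_means_vanish[OF \<nu>(1) cT]
    by (rule transfer) (use that mixing_iff_means_vanish[OF inv cT] in \<open>auto simp: averaging_def\<close>)
  moreover have "ergodic T \<nu>" if "\<forall>m\<ge>1. ergodic T (\<mu> m)"
    unfolding ergodic_iff_means_vanish[OF \<nu>(1) cT]
    by (rule transfer) (use that ergodic_iff_means_vanish[OF inv cT] in \<open>auto simp: averaging_def\<close>)
  ultimately show ?thesis using \<nu> by blast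
qed

end
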